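(* Let $G$ be a group with property $\mathrm{PHP}$ that contains a non-abelian free subgroup whose cardinality is the same as that of $G$. Then, for every domain $R$ with $|R|\leq |G|$, the group ring $RG$ is (right) primitive. Moreover, the group ring $KG$ is (right) primitive for every field $K$ (with no restriction on the cardinality of $K$).
   Context: A ring $A$ is (right) primitive if it has a faithful irreducible (i.e. simple) right $A$-module. Here a domain is a non-zero ring with identity and without zero divisors (commutativity is not assumed). $RG$ is the usual group ring: finite formal sums $\sum r_g g$ with $r_g\in R$, with coefficients commuting with group elements. Property $\mathrm{PHP}$ (Ozawa): a group $G$ has property $\mathrm{PHP}$ if for every finite $F\subseteq G$ and every $\varepsilon>0$ there exists $N\geq 1$ such that for all integers $n\geq N$ there are elements $t_1,\ldots,t_n\in G$ and subsets $C_i\subseteq D_i\subseteq G$ ($1\leq i\leq n$) such that: (1) the sets $aC_i$ ($a\in F$, $1\leq i\leq n$) together with the sets $at_i^{-1}(G\setminus D_i)$ ($a\in F$, $1\leq i\leq n$) are pairwise disjoint, as an indexed family (i.e. members with different type or different index $(a,i)$ are disjoint); (2) for every $x\in G$, the set $J(x):=\{i: x\in D_i\}\cup\{i: x\in t_i^{-1}(G\setminus C_i)\}$ has cardinality at most $\varepsilon\sqrt{n}$. *)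

theory Defs
  imports
    Complex_Main
    "HOL-Algebra.Module"
    "HOL-Algebra.Coset"
    "HOL-Library.Equipollence"
    "HOL-Library.Disjoint_Sets"
begin

section \<open>Rings, right modules and primitivity\<close>

text \<open>
  The locale \<^locale>\<open>domain\<close> of the library is commutative; the domains considered
  here need not be.
\<close>

locale nc_domain = ring R for R (structure) +
  assumes one_not_zero: "\<one> \<noteq> \<zero>"
    and no_zero_divisors:
      "\<lbrakk>a \<in> carrier R; b \<in> carrier R; a \<otimes> b = \<zero>\<rbrakk> \<Longrightarrow> a = \<zero> \<or> b = \<zero>"

text \<open>
  The locale \<^locale>\<open>module\<close> of the library is about modules over commutative rings.  As
  there, the fields \<^const>\<open>mult\<close> and \<^const>\<open>one\<close> of the record are irrelevant.
\<close>

record ('a, 'm) right_module = "'m ring" +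
  ract :: "['m, 'a] \<Rightarrow> 'm" (infixl \<open>\<lhd>\<index>\<close> 70)

locale right_module = R?: ring R + M?: abelian_group M
    for R :: "('a, 'z) ring_scheme" (structure)
    and M :: "('a, 'm, 'w) right_module_scheme" (structure) +
  assumes ract_closed:
      "\<lbrakk>m \<in> carrier M; a \<in> carrier R\<rbrakk> \<Longrightarrow> m \<lhd>\<^bsub>M\<^esub> a \<in> carrier M"
    and ract_add_left:
      "\<lbrakk>m \<in> carrier M; n \<in> carrier M; a \<in> carrier R\<rbrakk> \<Longrightarrow>
        (m \<oplus>\<^bsub>M\<^esub> n) \<lhd>\<^bsub>M\<^esub> a = (m \<lhd>\<^bsub>M\<^esub> a) \<oplus>\<^bsub>M\<^esub> (n \<lhd>\<^bsub>M\<^esub> a)"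
    and ract_add_right:
      "\<lbrakk>m \<in> carrier M; a \<in> carrier R; b \<in> carrier R\<rbrakk> \<Longrightarrow>
        m \<lhd>\<^bsub>M\<^esub> (a \<oplus>\<^bsub>R\<^esub> b) = (m \<lhd>\<^bsub>M\<^esub> a) \<oplus>\<^bsub>M\<^esub> (m \<lhd>\<^bsub>M\<^esub> b)"
    and ract_mult:
      "\<lbrakk>m \<in> carrier M; a \<in> carrier R; b \<in> carrier R\<rbrakk> \<Longrightarrow>
        m \<lhd>\<^bsub>M\<^esub> (a \<otimes>\<^bsub>R\<^esub> b) = (m \<lhd>\<^bsub>M\<^esub> a) \<lhd>\<^bsub>M\<^esub> b"
    and ract_one:
      "m \<in> carrier M \<Longrightarrow> m \<lhd>\<^bsub>M\<^esub> \<one>\<^bsub>R\<^esub> = m"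

definition right_submodule ::
    "'m set \<Rightarrow> ('a, 'z) ring_scheme \<Rightarrow> ('a, 'm, 'w) right_module_scheme \<Rightarrow> bool" where
  "right_submodule N R M \<longleftrightarrow>
     subgroup N (add_monoid M) \<and> (\<forall>n\<in>N. \<forall>a\<in>carrier R. n \<lhd>\<^bsub>M\<^esub> a \<in> N)"

definition irreducible_right_module ::
    "('a, 'z) ring_scheme \<Rightarrow> ('a, 'm, 'w) right_module_scheme \<Rightarrow> bool" where
  "irreducible_right_module R M \<longleftrightarrow>
     right_module R M \<and> carrier M \<noteq> {\<zero>\<^bsub>M\<^esub>} \<and>
     (\<forall>N. right_submodule N R M \<longrightarrow> N = {\<zero>\<^bsub>M\<^esub>} \<or> N = carrier M)"

definition faithful_right_module ::
    "('a, 'z) ring_scheme \<Rightarrow> ('a, 'm, 'w) right_module_scheme \<Rightarrow> bool" where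
  "faithful_right_module R M \<longleftrightarrow>
     right_module R M \<and>
     (\<forall>a\<in>carrier R. (\<forall>m\<in>carrier M. m \<lhd>\<^bsub>M\<^esub> a = \<zero>\<^bsub>M\<^esub>) \<longrightarrow> a = \<zero>\<^bsub>R\<^esub>)"

text \<open>
  One cannot quantify existentially over the type of module elements.  Sets of ring elements
  suffice, because an irreducible right module is a quotient of the ring by a right ideal; see
  lemma \<open>right_primitiveI\<close> below.
\<close>

definition right_primitive :: "('a, 'z) ring_scheme \<Rightarrow> bool" where
  "right_primitive R \<longleftrightarrow>
     (\<exists>M :: ('a, 'a set) right_module.
        irreducible_right_module R M \<and> faithful_right_module R M)"

lemma right_primitive_transport:
  fixes R :: "('a, 'z) ring_scheme" and M :: "('a, 'm, 'w) right_module_scheme"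
    and f :: "'m \<Rightarrow> 'a set"
  assumes irr: "irreducible_right_module R M" and faith: "faithful_right_module R M"
    and inj: "inj_on f (carrier M)"
  shows "right_primitive R"
proof -
  interpret M: right_module R M
    using irr by (simp add: irreducible_right_module_def)
  define g where "g = the_inv_into (carrier M) f"
  have gf: "g (f m) = m" if "m \<in> carrier M" for m
    using that inj by (simp add: g_def the_inv_into_f_f)
  define N :: "('a, 'a set) right_module" where
    "N = \<lparr>carrier = f ` carrier M, mult = undefined, one = undefined, zero = f \<zero>\<^bsub>M\<^esub>,
          add = (\<lambda>x y. f (g x \<oplus>\<^bsub>M\<^esub> g y)), ract = (\<lambda>x a. f (g x \<lhd>\<^bsub>M\<^esub> a))\<rparr>"
  have cN: "carrier N = f ` carrier M" and zN: "\<zero>\<^bsub>N\<^esub> = f \<zero>\<^bsub>M\<^esub>" by (simp_all add: N_def)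
  have aN: "f m \<oplus>\<^bsub>N\<^esub> f n = f (m \<oplus>\<^bsub>M\<^esub> n)" if "m \<in> carrier M" "n \<in> carrier M" for m n
    using that by (simp add: N_def gf)
  have rN: "f m \<lhd>\<^bsub>N\<^esub> a = f (m \<lhd>\<^bsub>M\<^esub> a)" if "m \<in> carrier M" for m a
    using that by (simp add: N_def gf)
  have N: "abelian_group N"
  proof (rule abelian_groupI)
    fix x assume "x \<in> carrier N"
    then obtain m where m: "m \<in> carrier M" "x = f m" by (auto simp: cN)
    have "f (\<ominus>\<^bsub>M\<^esub> m) \<oplus>\<^bsub>N\<^esub> x = \<zero>\<^bsub>N\<^esub>" using m by (simp add: aN zN M.l_neg)
    then show "\<exists>y\<in>carrier N. y \<oplus>\<^bsub>N\<^esub> x = \<zero>\<^bsub>N\<^esub>" using m by (auto simp: cN)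
  next
    fix x y assume "x \<in> carrier N" "y \<in> carrier N"
    then obtain m n where "m \<in> carrier M" "x = f m" "n \<in> carrier M" "y = f n"
      by (auto simp: cN)
    then show "x \<oplus>\<^bsub>N\<^esub> y = y \<oplus>\<^bsub>N\<^esub> x" by (simp add: aN M.a_comm)
  qed (auto simp: cN zN aN M.a_assoc)
  interpret N: right_module R N
    by (intro right_module.intro right_module_axioms.intro M.ring_axioms N)
      (auto simp: cN zN aN rN M.ract_closed M.ract_add_left M.ract_add_right
        M.ract_mult M.ract_one)
  have irrN: "irreducible_right_module R N"
    unfolding irreducible_right_module_def
  proof (intro conjI allI impI)
    show "right_module R N" by (rule N.right_module_axioms)
    show "carrier N \<noteq> {\<zero>\<^bsub>N\<^esub>}"
    proof
      assume "carrier N = {\<zero>\<^bsub>N\<^esub>}"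
      then have "m = \<zero>\<^bsub>M\<^esub>" if "m \<in> carrier M" for m
        using that by (metis M.zero_closed cN gf imageI singletonD zN)
      then show False using irr by (auto simp: irreducible_right_module_def)
    qed
    fix K assume K: "right_submodule K R N"
    then have sg: "subgroup K (add_monoid N)" by (simp add: right_submodule_def)
    have Ksub: "K \<subseteq> f ` carrier M" using subgroup.subset[OF sg] by (simp add: cN)
    define L where "L = {m \<in> carrier M. f m \<in> K}"
    have KL: "K = f ` L" using Ksub by (auto simp: L_def)
    have "right_submodule L R M"
      unfolding right_submodule_def
    proof (intro conjI ballI)
      show "subgroup L (add_monoid M)"
      proof (rule M.add.subgroupI)
        show "L \<subseteq> carrier M" by (auto simp: L_def)
        show "L \<noteq> {}" using subgroup.one_closed[OF sg] by (auto simp: L_def zN)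
      next
        fix m assume m: "m \<in> L"
        then have mc: "m \<in> carrier M" and mk: "f m \<in> K" by (auto simp: L_def)
        have "\<ominus>\<^bsub>N\<^esub> f m = f (\<ominus>\<^bsub>M\<^esub> m)"
          by (rule N.minus_equality) (use mc in \<open>auto simp: aN zN cN M.l_neg\<close>)
        moreover have "\<ominus>\<^bsub>N\<^esub> f m \<in> K"
          using subgroup.m_inv_closed[OF sg mk] by (simp add: a_inv_def)
        ultimately show "\<ominus>\<^bsub>M\<^esub> m \<in> L" using mc by (simp add: L_def)
      next
        fix m n assume "m \<in> L" "n \<in> L"
        then show "m \<oplus>\<^bsub>M\<^esub> n \<in> L"
          using subgroup.m_closed[OF sg, of "f m" "f n"] by (auto simp: L_def aN)
      qed
      fix m a assume "m \<in> L" "a \<in> carrier R"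
      then show "m \<lhd>\<^bsub>M\<^esub> a \<in> L"
        using K by (auto simp: L_def right_submodule_def rN M.ract_closed)
    qed
    then have "L = {\<zero>\<^bsub>M\<^esub>} \<or> L = carrier M"
      using irr by (simp add: irreducible_right_module_def)
    then show "K = {\<zero>\<^bsub>N\<^esub>} \<or> K = carrier N" by (auto simp: KL zN cN)
  qed
  have "faithful_right_module R N"
    unfolding faithful_right_module_def
  proof (intro conjI ballI impI)
    show "right_module R N" by (rule N.right_module_axioms)
    fix a assume a: "a \<in> carrier R" and z: "\<forall>m\<in>carrier N. m \<lhd>\<^bsub>N\<^esub> a = \<zero>\<^bsub>N\<^esub>"
    have "m \<lhd>\<^bsub>M\<^esub> a = \<zero>\<^bsub>M\<^esub>" if "m \<in> carrier M" for m
    proof -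
      have "f (m \<lhd>\<^bsub>M\<^esub> a) = f \<zero>\<^bsub>M\<^esub>" using z that by (auto simp: cN zN rN)
      then show ?thesis using that a by (metis gf M.ract_closed M.zero_closed)
    qed
    then show "a = \<zero>\<^bsub>R\<^esub>" using faith a by (simp add: faithful_right_module_def)
  qed
  with irrN show ?thesis unfolding right_primitive_def by blast
qed

lemma right_primitiveI:
  fixes R :: "('a, 'z) ring_scheme" and M :: "('a, 'm, 'w) right_module_scheme"
  assumes irr: "irreducible_right_module R M" and faith: "faithful_right_module R M"
  shows "right_primitive R"
proof -
  interpret M: right_module R M
    using irr by (simp add: irreducible_right_module_def)
  have "carrier M \<noteq> {\<zero>\<^bsub>M\<^esub>}" using irr by (simp add: irreducible_right_module_def)
  then obtain u where u: "u \<in> carrier M" "u \<noteq> \<zero>\<^bsub>M\<^esub>" using M.zero_closed by auto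
  define U where "U = (\<lambda>a. u \<lhd>\<^bsub>M\<^esub> a) ` carrier R"
  have "right_submodule U R M"
    unfolding right_submodule_def
  proof (intro conjI ballI)
    show "subgroup U (add_monoid M)"
    proof (rule M.add.subgroupI)
      show "U \<subseteq> carrier M" using u by (auto simp: U_def M.ract_closed)
      show "U \<noteq> {}" by (auto simp: U_def)
    next
      fix m assume "m \<in> U"
      then obtain a where a: "a \<in> carrier R" "m = u \<lhd>\<^bsub>M\<^esub> a" by (auto simp: U_def)
      have z: "u \<lhd>\<^bsub>M\<^esub> \<zero>\<^bsub>R\<^esub> = \<zero>\<^bsub>M\<^esub>"
        using M.ract_add_right[OF u(1), of "\<zero>\<^bsub>R\<^esub>" "\<zero>\<^bsub>R\<^esub>"] M.ract_closed[OF u(1), of "\<zero>\<^bsub>R\<^esub>"]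
        by (metis M.R.r_zero M.R.zero_closed M.M.add.l_cancel_one')
      have "\<ominus>\<^bsub>M\<^esub> m = u \<lhd>\<^bsub>M\<^esub> (\<ominus>\<^bsub>R\<^esub> a)"
      proof (rule M.M.minus_equality)
        show "(u \<lhd>\<^bsub>M\<^esub> (\<ominus>\<^bsub>R\<^esub> a)) \<oplus>\<^bsub>M\<^esub> m = \<zero>\<^bsub>M\<^esub>"
          using a u z M.ract_add_right[OF u(1), of "\<ominus>\<^bsub>R\<^esub> a" a] by (simp add: M.R.l_neg)
      qed (use a u in \<open>auto simp: M.ract_closed\<close>)
      then show "\<ominus>\<^bsub>M\<^esub> m \<in> U" using a by (auto simp: U_def)
    next
      fix m n assume "m \<in> U" "n \<in> U"
      then show "m \<oplus>\<^bsub>M\<^esub> n \<in> U"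
        using u by (auto simp: U_def M.ract_add_right[symmetric])
    qed
    fix m a assume "m \<in> U" "a \<in> carrier R"
    then show "m \<lhd>\<^bsub>M\<^esub> a \<in> U" using u by (auto simp: U_def M.ract_mult[symmetric])
  qed
  moreover have "u \<in> U" unfolding U_def using u M.ract_one by (metis M.R.one_closed imageI)
  ultimately have U: "carrier M = U" using irr u by (auto simp: irreducible_right_module_def)
  have "\<exists>a\<in>carrier R. u \<lhd>\<^bsub>M\<^esub> a = m" if "m \<in> carrier M" for m
    using that unfolding U by (auto simp: U_def)
  then have "inj_on (\<lambda>m. {a \<in> carrier R. u \<lhd>\<^bsub>M\<^esub> a = m}) (carrier M)"
    by (intro inj_onI) blast
  then show ?thesis by (rule right_primitive_transport[OF irr faith])
qed


section \<open>Group rings\<close>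

text \<open>
  A formal sum is its coefficient function, which is zero outside the carrier of the group; the
  product is convolution.
\<close>

definition group_ring ::
    "('r, 'y) ring_scheme \<Rightarrow> ('g, 'x) monoid_scheme \<Rightarrow> ('g \<Rightarrow> 'r) ring" where
  "group_ring R G =
    \<lparr>carrier = {f. (\<forall>g\<in>carrier G. f g \<in> carrier R) \<and>
                    (\<forall>g. g \<notin> carrier G \<longrightarrow> f g = \<zero>\<^bsub>R\<^esub>) \<and>
                    finite {g \<in> carrier G. f g \<noteq> \<zero>\<^bsub>R\<^esub>}},
     mult = (\<lambda>f h g. if g \<in> carrier G
               then \<Oplus>\<^bsub>R\<^esub>x\<in>{x \<in> carrier G. f x \<noteq> \<zero>\<^bsub>R\<^esub>}. f x \<otimes>\<^bsub>R\<^esub> h (inv\<^bsub>G\<^esub> x \<otimes>\<^bsub>G\<^esub> g)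
               else \<zero>\<^bsub>R\<^esub>),
     one = (\<lambda>g. if g = \<one>\<^bsub>G\<^esub> then \<one>\<^bsub>R\<^esub> else \<zero>\<^bsub>R\<^esub>),
     zero = (\<lambda>_. \<zero>\<^bsub>R\<^esub>),
     add = (\<lambda>f h g. f g \<oplus>\<^bsub>R\<^esub> h g)\<rparr>"

lemma (in abelian_monoid) finsum_mono_neutral:
  assumes "finite T" "S \<subseteq> T" "\<And>x. x \<in> T - S \<Longrightarrow> p x = \<zero>\<^bsub>G\<^esub>"
    and "\<And>x. x \<in> T \<Longrightarrow> p x \<in> carrier G"
  shows "finsum G p S = finsum G p T"
  using assms by (intro add.finprod_mono_neutral_cong_left) auto

lemma finsum_swap:
  assumes "abelian_monoid R" "finite A" "finite B"
    and "\<And>x y. x \<in> A \<Longrightarrow> y \<in> B \<Longrightarrow> p x y \<in> carrier R"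
  shows "(\<Oplus>\<^bsub>R\<^esub>x\<in>A. \<Oplus>\<^bsub>R\<^esub>y\<in>B. p x y) = (\<Oplus>\<^bsub>R\<^esub>y\<in>B. \<Oplus>\<^bsub>R\<^esub>x\<in>A. p x y)"
proof -
  interpret abelian_monoid R by fact
  show ?thesis
    using assms(2,4)
  proof (induction A rule: finite_induct)
    case empty
    then show ?case by (simp add: finsum_zero)
  next
    case (insert a A)
    have "(\<Oplus>\<^bsub>R\<^esub>y\<in>B. \<Oplus>\<^bsub>R\<^esub>x\<in>insert a A. p x y) = (\<Oplus>\<^bsub>R\<^esub>y\<in>B. p a y \<oplus>\<^bsub>R\<^esub> (\<Oplus>\<^bsub>R\<^esub>x\<in>A. p x y))"
      using insert by (intro finsum_cong') (auto simp: Pi_def)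
    also have "\<dots> = (\<Oplus>\<^bsub>R\<^esub>y\<in>B. p a y) \<oplus>\<^bsub>R\<^esub> (\<Oplus>\<^bsub>R\<^esub>y\<in>B. \<Oplus>\<^bsub>R\<^esub>x\<in>A. p x y)"
      using insert by (intro finsum_addf) (auto simp: Pi_def)
    finally show ?case using insert by (simp add: Pi_def)
  qed
qed

lemma group_ring_is_ring:
  assumes "ring R" "group G"
  shows "ring (group_ring R G)"
proof -
  interpret R: ring R by fact
  interpret G: group G by fact
  let ?A = "group_ring R G"
  define supp where "supp f = {x \<in> carrier G. f x \<noteq> \<zero>\<^bsub>R\<^esub>}" for f
  have carr: "f \<in> carrier ?A \<longleftrightarrow> (\<forall>g\<in>carrier G. f g \<in> carrier R) \<and>
      (\<forall>g. g \<notin> carrier G \<longrightarrow> f g = \<zero>\<^bsub>R\<^esub>) \<and> finite (supp f)" for f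
    by (simp add: group_ring_def supp_def)
  have mul0: "(f \<otimes>\<^bsub>?A\<^esub> h) g = (\<Oplus>\<^bsub>R\<^esub>x\<in>supp f. f x \<otimes>\<^bsub>R\<^esub> h (inv\<^bsub>G\<^esub> x \<otimes>\<^bsub>G\<^esub> g))"
    if "g \<in> carrier G" for f h g
    using that by (simp add: group_ring_def supp_def)
  have mulout: "(f \<otimes>\<^bsub>?A\<^esub> h) g = \<zero>\<^bsub>R\<^esub>" if "g \<notin> carrier G" for f h g
    using that by (simp add: group_ring_def)
  have add: "(f \<oplus>\<^bsub>?A\<^esub> h) g = f g \<oplus>\<^bsub>R\<^esub> h g" for f h g by (simp add: group_ring_def)
  have one: "\<one>\<^bsub>?A\<^esub> g = (if g = \<one>\<^bsub>G\<^esub> then \<one>\<^bsub>R\<^esub> else \<zero>\<^bsub>R\<^esub>)" for g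
    by (simp add: group_ring_def)
  have zero: "\<zero>\<^bsub>?A\<^esub> g = \<zero>\<^bsub>R\<^esub>" for g by (simp add: group_ring_def)
  have carrI: "f \<in> carrier ?A" if "\<And>g. g \<in> carrier G \<Longrightarrow> f g \<in> carrier R"
    "\<And>g. g \<notin> carrier G \<Longrightarrow> f g = \<zero>\<^bsub>R\<^esub>" "finite (supp f)" for f
    using that by (simp add: carr)
  have c [simp]: "f g \<in> carrier R" if "f \<in> carrier ?A" for f g
    using that by (cases "g \<in> carrier G") (auto simp: carr)
  have out: "f g = \<zero>\<^bsub>R\<^esub>" if "f \<in> carrier ?A" "g \<notin> carrier G" for f g
    using that by (auto simp: carr)
  have fin [simp]: "finite (supp f)" if "f \<in> carrier ?A" for f
    using that by (auto simp: carr)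
  have sc: "x \<in> carrier G" if "x \<in> supp f" for x f using that by (simp add: supp_def)
  have mul: "(f \<otimes>\<^bsub>?A\<^esub> h) g = (\<Oplus>\<^bsub>R\<^esub>x\<in>T. f x \<otimes>\<^bsub>R\<^esub> h (inv\<^bsub>G\<^esub> x \<otimes>\<^bsub>G\<^esub> g))"
    if "f \<in> carrier ?A" "h \<in> carrier ?A" "g \<in> carrier G" "finite T" "supp f \<subseteq> T"
      "T \<subseteq> carrier G" for f h g T
  proof -
    have "(f \<otimes>\<^bsub>?A\<^esub> h) g = (\<Oplus>\<^bsub>R\<^esub>x\<in>supp f. f x \<otimes>\<^bsub>R\<^esub> h (inv\<^bsub>G\<^esub> x \<otimes>\<^bsub>G\<^esub> g))"
      using that(3) by (rule mul0)
    also have "\<dots> = (\<Oplus>\<^bsub>R\<^esub>x\<in>T. f x \<otimes>\<^bsub>R\<^esub> h (inv\<^bsub>G\<^esub> x \<otimes>\<^bsub>G\<^esub> g))"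
      using that by (intro R.finsum_mono_neutral)
        (auto simp: supp_def)
    finally show ?thesis .
  qed
  define P where "P f h = (\<lambda>(x, y). x \<otimes>\<^bsub>G\<^esub> y) ` (supp f \<times> supp h)" for f h
  have Pf [simp]: "finite (P f h)" if "f \<in> carrier ?A" "h \<in> carrier ?A" for f h
    using that by (simp add: P_def)
  have Pc: "P f h \<subseteq> carrier G" for f h by (auto simp: P_def supp_def)
  have suppP: "supp (f \<otimes>\<^bsub>?A\<^esub> h) \<subseteq> P f h"
    if "f \<in> carrier ?A" "h \<in> carrier ?A" for f h
  proof
    fix g assume g: "g \<in> supp (f \<otimes>\<^bsub>?A\<^esub> h)"
    then have gc: "g \<in> carrier G" by (rule sc)
    show "g \<in> P f h"
    proof (rule ccontr)
      assume n: "g \<notin> P f h"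
      have z: "h (inv\<^bsub>G\<^esub> x \<otimes>\<^bsub>G\<^esub> g) = \<zero>\<^bsub>R\<^esub>" if x: "x \<in> supp f" for x
      proof (rule ccontr)
        assume "h (inv\<^bsub>G\<^esub> x \<otimes>\<^bsub>G\<^esub> g) \<noteq> \<zero>\<^bsub>R\<^esub>"
        then have "inv\<^bsub>G\<^esub> x \<otimes>\<^bsub>G\<^esub> g \<in> supp h" using x gc by (simp add: supp_def)
        then have "x \<otimes>\<^bsub>G\<^esub> (inv\<^bsub>G\<^esub> x \<otimes>\<^bsub>G\<^esub> g) \<in> P f h" using x by (auto simp: P_def)
        then show False
          using n x gc by (simp add: sc G.m_assoc[symmetric])
      qed
      have "(f \<otimes>\<^bsub>?A\<^esub> h) g = (\<Oplus>\<^bsub>R\<^esub>x\<in>supp f. f x \<otimes>\<^bsub>R\<^esub> h (inv\<^bsub>G\<^esub> x \<otimes>\<^bsub>G\<^esub> g))"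
        using that gc by (intro mul) (auto simp: sc)
      also have "\<dots> = (\<Oplus>\<^bsub>R\<^esub>x\<in>supp f. \<zero>\<^bsub>R\<^esub>)"
        using that z by (intro R.finsum_cong') auto
      finally show False using g by (simp add: supp_def R.finsum_zero)
    qed
  qed
  have mc: "f \<otimes>\<^bsub>?A\<^esub> h \<in> carrier ?A" if "f \<in> carrier ?A" "h \<in> carrier ?A" for f h
  proof -
    have "(f \<otimes>\<^bsub>?A\<^esub> h) g \<in> carrier R" if "g \<in> carrier G" for g
      using mul[OF \<open>f \<in> _\<close> \<open>h \<in> _\<close> that fin[OF \<open>f \<in> _\<close>] order_refl] \<open>f \<in> _\<close> \<open>h \<in> _\<close>
      by (auto simp: sc subset_iff)
    moreover have "finite (supp (f \<otimes>\<^bsub>?A\<^esub> h))"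
      using finite_subset[OF suppP[OF that]] that by simp
    ultimately show ?thesis by (intro carrI) (simp_all add: mulout)
  qed
  have ac: "f \<oplus>\<^bsub>?A\<^esub> h \<in> carrier ?A" if "f \<in> carrier ?A" "h \<in> carrier ?A" for f h
  proof -
    have "supp (f \<oplus>\<^bsub>?A\<^esub> h) \<subseteq> supp f \<union> supp h" by (auto simp: supp_def add)
    then have "finite (supp (f \<oplus>\<^bsub>?A\<^esub> h))" using that by (meson fin finite_UnI finite_subset)
    then show ?thesis using that by (intro carrI) (simp_all add: add out)
  qed
  have oc: "\<one>\<^bsub>?A\<^esub> \<in> carrier ?A"
  proof -
    have "supp \<one>\<^bsub>?A\<^esub> \<subseteq> {\<one>\<^bsub>G\<^esub>}" by (auto simp: supp_def one split: if_splits)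
    then have "finite (supp \<one>\<^bsub>?A\<^esub>)" by (rule finite_subset) simp
    then show ?thesis by (intro carrI) (auto simp: one)
  qed
  have zc: "\<zero>\<^bsub>?A\<^esub> \<in> carrier ?A" by (intro carrI) (simp_all add: zero supp_def)
  show ?thesis
  proof (rule ringI)
    show "abelian_group ?A"
    proof (rule abelian_groupI)
      fix f assume f: "f \<in> carrier ?A"
      let ?n = "\<lambda>g. \<ominus>\<^bsub>R\<^esub> f g"
      have "supp ?n \<subseteq> supp f" by (auto simp: supp_def)
      then have "finite (supp ?n)" using f by (meson fin finite_subset)
      then have "?n \<in> carrier ?A" using f by (intro carrI) (simp_all add: out)
      moreover have "?n \<oplus>\<^bsub>?A\<^esub> f = \<zero>\<^bsub>?A\<^esub>"
        using f by (intro ext) (simp add: add zero R.l_neg)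
      ultimately show "\<exists>h\<in>carrier ?A. h \<oplus>\<^bsub>?A\<^esub> f = \<zero>\<^bsub>?A\<^esub>" by blast
    qed (auto simp: ac zc fun_eq_iff add zero R.a_ac)
    show "monoid ?A"
    proof (rule monoidI)
      fix f h k assume f: "f \<in> carrier ?A" and h: "h \<in> carrier ?A" and k: "k \<in> carrier ?A"
      show "f \<otimes>\<^bsub>?A\<^esub> h \<otimes>\<^bsub>?A\<^esub> k = f \<otimes>\<^bsub>?A\<^esub> (h \<otimes>\<^bsub>?A\<^esub> k)"
      proof
        fix g
        show "(f \<otimes>\<^bsub>?A\<^esub> h \<otimes>\<^bsub>?A\<^esub> k) g = (f \<otimes>\<^bsub>?A\<^esub> (h \<otimes>\<^bsub>?A\<^esub> k)) g"
        proof (cases "g \<in> carrier G")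
          case g: True
          let ?q = "\<lambda>x y. f x \<otimes>\<^bsub>R\<^esub> (h (inv\<^bsub>G\<^esub> x \<otimes>\<^bsub>G\<^esub> y) \<otimes>\<^bsub>R\<^esub> k (inv\<^bsub>G\<^esub> y \<otimes>\<^bsub>G\<^esub> g))"
          have "(f \<otimes>\<^bsub>?A\<^esub> h \<otimes>\<^bsub>?A\<^esub> k) g
              = (\<Oplus>\<^bsub>R\<^esub>y\<in>P f h. (f \<otimes>\<^bsub>?A\<^esub> h) y \<otimes>\<^bsub>R\<^esub> k (inv\<^bsub>G\<^esub> y \<otimes>\<^bsub>G\<^esub> g))"
            using f h k g by (intro mul mc suppP Pc) auto
          also have "\<dots> = (\<Oplus>\<^bsub>R\<^esub>y\<in>P f h. \<Oplus>\<^bsub>R\<^esub>x\<in>supp f. ?q x y)"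
          proof (intro R.finsum_cong' refl)
            fix y assume "y \<in> P f h"
            then have y: "y \<in> carrier G" using Pc by auto
            have "(f \<otimes>\<^bsub>?A\<^esub> h) y = (\<Oplus>\<^bsub>R\<^esub>x\<in>supp f. f x \<otimes>\<^bsub>R\<^esub> h (inv\<^bsub>G\<^esub> x \<otimes>\<^bsub>G\<^esub> y))"
              using f h y by (intro mul) (auto simp: sc)
            then show "(f \<otimes>\<^bsub>?A\<^esub> h) y \<otimes>\<^bsub>R\<^esub> k (inv\<^bsub>G\<^esub> y \<otimes>\<^bsub>G\<^esub> g) = (\<Oplus>\<^bsub>R\<^esub>x\<in>supp f. ?q x y)"
              using f h k by (simp add: R.finsum_ldistr R.m_assoc Pi_def)
          qed (use f h k in auto)
          also have "\<dots> = (\<Oplus>\<^bsub>R\<^esub>x\<in>supp f. \<Oplus>\<^bsub>R\<^esub>y\<in>P f h. ?q x y)"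
            using f h k by (intro finsum_swap R.abelian_monoid_axioms) auto
          also have "\<dots> = (\<Oplus>\<^bsub>R\<^esub>x\<in>supp f. f x \<otimes>\<^bsub>R\<^esub> (h \<otimes>\<^bsub>?A\<^esub> k) (inv\<^bsub>G\<^esub> x \<otimes>\<^bsub>G\<^esub> g))"
          proof (intro R.finsum_cong' refl)
            fix x assume xs: "x \<in> supp f"
            then have x: "x \<in> carrier G" by (rule sc)
            let ?r = "\<lambda>y. h (inv\<^bsub>G\<^esub> x \<otimes>\<^bsub>G\<^esub> y) \<otimes>\<^bsub>R\<^esub> k (inv\<^bsub>G\<^esub> y \<otimes>\<^bsub>G\<^esub> g)"
            have inj: "inj_on (\<lambda>z. x \<otimes>\<^bsub>G\<^esub> z) (supp h)"
              using x by (auto simp: inj_on_def sc)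
            have "(\<Oplus>\<^bsub>R\<^esub>y\<in>P f h. ?r y) = (\<Oplus>\<^bsub>R\<^esub>y\<in>(\<lambda>z. x \<otimes>\<^bsub>G\<^esub> z) ` supp h. ?r y)"
            proof (intro R.finsum_mono_neutral[symmetric])
              show "(\<lambda>z. x \<otimes>\<^bsub>G\<^esub> z) ` supp h \<subseteq> P f h" using xs by (auto simp: P_def)
              fix y assume y: "y \<in> P f h - (\<lambda>z. x \<otimes>\<^bsub>G\<^esub> z) ` supp h"
              then have yc: "y \<in> carrier G" using Pc by auto
              have "h (inv\<^bsub>G\<^esub> x \<otimes>\<^bsub>G\<^esub> y) = \<zero>\<^bsub>R\<^esub>"
              proof (rule ccontr)
                assume "h (inv\<^bsub>G\<^esub> x \<otimes>\<^bsub>G\<^esub> y) \<noteq> \<zero>\<^bsub>R\<^esub>"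
                then have "inv\<^bsub>G\<^esub> x \<otimes>\<^bsub>G\<^esub> y \<in> supp h" using x yc by (simp add: supp_def)
                moreover have "y = x \<otimes>\<^bsub>G\<^esub> (inv\<^bsub>G\<^esub> x \<otimes>\<^bsub>G\<^esub> y)"
                  using x yc by (simp add: G.m_assoc[symmetric])
                ultimately show False using y by blast
              qed
              then show "?r y = \<zero>\<^bsub>R\<^esub>" using k by simp
            qed (use f h k in auto)
            also have "\<dots> = (\<Oplus>\<^bsub>R\<^esub>z\<in>supp h. ?r (x \<otimes>\<^bsub>G\<^esub> z))"
              using inj h k by (intro R.finsum_reindex) auto
            also have "\<dots> = (\<Oplus>\<^bsub>R\<^esub>z\<in>supp h. h z \<otimes>\<^bsub>R\<^esub> k (inv\<^bsub>G\<^esub> z \<otimes>\<^bsub>G\<^esub> (inv\<^bsub>G\<^esub> x \<otimes>\<^bsub>G\<^esub> g)))"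
              using x g h k
              by (intro R.finsum_cong') (auto simp: sc G.m_assoc[symmetric] G.inv_mult_group)
            also have "\<dots> = (h \<otimes>\<^bsub>?A\<^esub> k) (inv\<^bsub>G\<^esub> x \<otimes>\<^bsub>G\<^esub> g)"
              using h k x g by (intro mul[symmetric]) (auto simp: sc)
            finally have "(\<Oplus>\<^bsub>R\<^esub>y\<in>P f h. ?r y) = (h \<otimes>\<^bsub>?A\<^esub> k) (inv\<^bsub>G\<^esub> x \<otimes>\<^bsub>G\<^esub> g)" .
            moreover have "(\<Oplus>\<^bsub>R\<^esub>y\<in>P f h. ?q x y) = f x \<otimes>\<^bsub>R\<^esub> (\<Oplus>\<^bsub>R\<^esub>y\<in>P f h. ?r y)"
              using f h k by (intro R.finsum_rdistr[symmetric]) auto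
            ultimately show "(\<Oplus>\<^bsub>R\<^esub>y\<in>P f h. ?q x y)
                = f x \<otimes>\<^bsub>R\<^esub> (h \<otimes>\<^bsub>?A\<^esub> k) (inv\<^bsub>G\<^esub> x \<otimes>\<^bsub>G\<^esub> g)" by simp
          qed (use f mc[OF h k] in auto)
          also have "\<dots> = (f \<otimes>\<^bsub>?A\<^esub> (h \<otimes>\<^bsub>?A\<^esub> k)) g"
            using f h k g by (intro mul[symmetric] mc) (auto simp: sc)
          finally show ?thesis .
        qed (simp add: mulout)
      qed
    next
      fix f assume f: "f \<in> carrier ?A"
      show "\<one>\<^bsub>?A\<^esub> \<otimes>\<^bsub>?A\<^esub> f = f"
      proof
        fix g
        show "(\<one>\<^bsub>?A\<^esub> \<otimes>\<^bsub>?A\<^esub> f) g = f g"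
        proof (cases "g \<in> carrier G")
          case True
          have "(\<one>\<^bsub>?A\<^esub> \<otimes>\<^bsub>?A\<^esub> f) g
              = (\<Oplus>\<^bsub>R\<^esub>x\<in>{\<one>\<^bsub>G\<^esub>}. \<one>\<^bsub>?A\<^esub> x \<otimes>\<^bsub>R\<^esub> f (inv\<^bsub>G\<^esub> x \<otimes>\<^bsub>G\<^esub> g))"
            using f oc True by (intro mul) (auto simp: supp_def one split: if_splits)
          then show ?thesis using f True by (simp add: one)
        qed (simp add: mulout out f)
      qed
      show "f \<otimes>\<^bsub>?A\<^esub> \<one>\<^bsub>?A\<^esub> = f"
      proof
        fix g
        show "(f \<otimes>\<^bsub>?A\<^esub> \<one>\<^bsub>?A\<^esub>) g = f g"
        proof (cases "g \<in> carrier G")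
          case True
          have "(f \<otimes>\<^bsub>?A\<^esub> \<one>\<^bsub>?A\<^esub>) g
              = (\<Oplus>\<^bsub>R\<^esub>x\<in>insert g (supp f). f x \<otimes>\<^bsub>R\<^esub> \<one>\<^bsub>?A\<^esub> (inv\<^bsub>G\<^esub> x \<otimes>\<^bsub>G\<^esub> g))"
            using f oc True by (intro mul) (auto simp: sc)
          also have "\<dots> = (\<Oplus>\<^bsub>R\<^esub>x\<in>insert g (supp f). if g = x then f x else \<zero>\<^bsub>R\<^esub>)"
          proof (intro R.finsum_cong' refl)
            fix x assume "x \<in> insert g (supp f)"
            then have x: "x \<in> carrier G" using True sc by auto
            have "inv\<^bsub>G\<^esub> x \<otimes>\<^bsub>G\<^esub> g = \<one>\<^bsub>G\<^esub> \<longleftrightarrow> g = x"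
              using x True by (metis G.inv_closed G.inv_equality G.inv_inv G.l_inv)
            then show "f x \<otimes>\<^bsub>R\<^esub> \<one>\<^bsub>?A\<^esub> (inv\<^bsub>G\<^esub> x \<otimes>\<^bsub>G\<^esub> g) = (if g = x then f x else \<zero>\<^bsub>R\<^esub>)"
              using f by (simp add: one)
          qed (use f in auto)
          also have "\<dots> = f g" using f by (intro R.finsum_singleton) auto
          finally show ?thesis .
        qed (simp add: mulout out f)
      qed
    qed (use mc oc in auto)
  next
    fix f h k assume f: "f \<in> carrier ?A" and h: "h \<in> carrier ?A" and k: "k \<in> carrier ?A"
    have T: "supp (f \<oplus>\<^bsub>?A\<^esub> h) \<subseteq> supp f \<union> supp h" by (auto simp: supp_def add)
    show "(f \<oplus>\<^bsub>?A\<^esub> h) \<otimes>\<^bsub>?A\<^esub> k = f \<otimes>\<^bsub>?A\<^esub> k \<oplus>\<^bsub>?A\<^esub> h \<otimes>\<^bsub>?A\<^esub> k"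
    proof
      fix g
      show "((f \<oplus>\<^bsub>?A\<^esub> h) \<otimes>\<^bsub>?A\<^esub> k) g = (f \<otimes>\<^bsub>?A\<^esub> k \<oplus>\<^bsub>?A\<^esub> h \<otimes>\<^bsub>?A\<^esub> k) g"
      proof (cases "g \<in> carrier G")
        case g: True
        let ?T = "supp f \<union> supp h"
        have T': "finite ?T" "?T \<subseteq> carrier G" using f h by (auto simp: sc)
        show ?thesis
          using f h k T T' by (simp add: add mul[OF _ k g, where T = ?T] ac R.l_distr Pi_def)
      qed (simp add: mulout add)
    qed
    show "k \<otimes>\<^bsub>?A\<^esub> (f \<oplus>\<^bsub>?A\<^esub> h) = k \<otimes>\<^bsub>?A\<^esub> f \<oplus>\<^bsub>?A\<^esub> k \<otimes>\<^bsub>?A\<^esub> h"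
    proof
      fix g
      show "(k \<otimes>\<^bsub>?A\<^esub> (f \<oplus>\<^bsub>?A\<^esub> h)) g = (k \<otimes>\<^bsub>?A\<^esub> f \<oplus>\<^bsub>?A\<^esub> k \<otimes>\<^bsub>?A\<^esub> h) g"
      proof (cases "g \<in> carrier G")
        case g: True
        have T': "finite (supp k)" "supp k \<subseteq> carrier G" using k by (auto simp: sc)
        show ?thesis
          using f h k T' g by (simp add: add mul[OF k _ g, where T = "supp k"] ac R.r_distr Pi_def)
      qed (simp add: mulout add)
    qed
  qed
qed

section \<open>Free groups\<close>

text \<open>
  The letters \<open>(s, True)\<close> and \<open>(s, False)\<close> stand for \<open>s\<close> and its inverse.  The group is free on
  \<open>S\<close> if the canonical map from the free group on \<open>S\<close>, that is from the reduced words, is a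
  bijection.
\<close>

definition reduced_words :: "'g set \<Rightarrow> ('g \<times> bool) list set" where
  "reduced_words S =
     {w \<in> lists (S \<times> UNIV). successively (\<lambda>(s, e) (t, d). \<not> (s = t \<and> e \<noteq> d)) w}"

definition word_value :: "('g, 'x) monoid_scheme \<Rightarrow> ('g \<times> bool) list \<Rightarrow> 'g" where
  "word_value G w =
     foldr (\<lambda>(s, e) h. (if e then s else inv\<^bsub>G\<^esub> s) \<otimes>\<^bsub>G\<^esub> h) w \<one>\<^bsub>G\<^esub>"

definition free_group :: "('g, 'x) monoid_scheme \<Rightarrow> bool" where
  "free_group G \<longleftrightarrow> group G \<and>
     (\<exists>S \<subseteq> carrier G. bij_betw (word_value G) (reduced_words S) (carrier G))"


section \<open>Ozawa's property PHP\<close>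

definition PHP :: "('g, 'x) monoid_scheme \<Rightarrow> bool" where
  "PHP G \<longleftrightarrow>
    (\<forall>F \<epsilon>. F \<subseteq> carrier G \<and> finite F \<and> (\<epsilon> :: real) > 0 \<longrightarrow>
      (\<exists>N\<ge>1. \<forall>n\<ge>N. \<exists>(t :: nat \<Rightarrow> 'g) (C :: nat \<Rightarrow> 'g set) (D :: nat \<Rightarrow> 'g set).
        (\<forall>i\<in>{1..n}. t i \<in> carrier G \<and> C i \<subseteq> D i \<and> D i \<subseteq> carrier G) \<and>
        disjoint_family_on
          (case_sum (\<lambda>(a, i). a <#\<^bsub>G\<^esub> C i)
                    (\<lambda>(a, i). (a \<otimes>\<^bsub>G\<^esub> inv\<^bsub>G\<^esub> (t i)) <#\<^bsub>G\<^esub> (carrier G - D i)))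
          ((F \<times> {1..n}) <+> (F \<times> {1..n})) \<and>
        (\<forall>x\<in>carrier G.
          real (card ({i \<in> {1..n}. x \<in> D i} \<union>
                      {i \<in> {1..n}. x \<in> inv\<^bsub>G\<^esub> (t i) <#\<^bsub>G\<^esub> (carrier G - C i)}))
            \<le> \<epsilon> * sqrt (real n))))"

end

theory Submission
  imports
    Defs
    "HOL-Algebra.Subrings"
    "HOL-Library.Countable_Set"
begin

text \<open>
  A ring is right primitive as soon as it has a proper right ideal \<open>I\<close> which contains, for every
  \<open>a \<noteq> 0\<close>, an element \<open>1 + e\<close> with \<open>e\<close> in the two-sided ideal generated by \<open>a\<close>: a maximal right
  ideal above \<open>I\<close> contains no nonzero two-sided ideal.  For the group ring we take (after Formanek)
  \<open>e = \<Sum> u a t\<close>, where \<open>t\<close> runs through elements provided by PHP and the factors \<open>u\<close>, for all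
  \<open>a\<close>, are distinct members of one free family; this is where the free subgroup has to be as large
  as the set of elements \<open>a\<close>.  PHP makes the supports of the \<open>a t r\<close> large compared with the
  support of \<open>r\<close>, for every \<open>r\<close>.  If a combination \<open>\<Sum> (1 + e) r\<close> were equal to \<open>1\<close>, the
  cancellations would produce a finite subgraph of the Cayley forest of the free family with more
  edges than vertices.

  For a field \<open>K\<close> of arbitrary size it is enough to let \<open>a\<close> run through the elements with
  coefficients in the image of the integers, because every nonzero ideal of \<open>KG\<close> contains a
  nonzero element of this kind.
\<close>

section \<open>Right ideals and primitivity\<close>

text \<open>The elements \<open>1 + e\<close> are fixed once and for all, while the right factors
  \<open>r\<close> in a relation \<open>\<Sum> (1 + e) r = 1\<close> are arbitrary. A single product
  \<open>a t r\<close> may be far smaller than \<open>r\<close> or even vanish (RG has zero divisors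
  as soon as G has torsion), so no single \<open>t\<close> can be trusted. PHP supplies a finite
  list of elements \<open>t\<close>, chosen before \<open>r\<close> is known, for which the supports
  of the \<open>a t r\<close> together are at least any prescribed multiple of the support of
  \<open>r\<close>. The free factors on the left then keep these large supports from cancelling one
  another completely. Freeness enters through a first-letter function on the group instead of
  through words. In this form it passes from the free subgroup to G coset by coset, and it bounds
  the number of edges by an injection, without any talk of cycles.\<close>

definition right_ideal :: "'a set \<Rightarrow> ('a, 'z) ring_scheme \<Rightarrow> bool" where
  "right_ideal I A \<longleftrightarrow> additive_subgroup I A \<and> (\<forall>x\<in>I. \<forall>a\<in>carrier A. x \<otimes>\<^bsub>A\<^esub> a \<in> I)"

context ring
begin

text \<open>Negatives are obtained as right multiples by \<open>\<ominus> \<one>\<close>.\<close>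

lemma right_idealI:
  assumes "I \<subseteq> carrier R" "\<zero> \<in> I" "\<And>x y. \<lbrakk>x \<in> I; y \<in> I\<rbrakk> \<Longrightarrow> x \<oplus> y \<in> I"
    and mult: "\<And>x a. \<lbrakk>x \<in> I; a \<in> carrier R\<rbrakk> \<Longrightarrow> x \<otimes> a \<in> I"
  shows "right_ideal I R"
proof -
  have "\<ominus> x \<in> I" if "x \<in> I" for x
    using mult[OF that, of "\<ominus> \<one>"] that assms(1) by (auto simp: r_minus)
  then have "subgroup I (add_monoid R)"
    using assms by (intro add.subgroupI) auto
  then show ?thesis
    using mult by (simp add: right_ideal_def additive_subgroup_def)
qed

text \<open>The explicit form, with one coefficient per index, lets the assumption that
  \<open>\<one>\<close> lies in the ideal be unfolded into a concrete finite equation.\<close>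

lemma right_ideal_generated:
  assumes a: "a \<in> T \<rightarrow> carrier R"
  defines "I \<equiv> {\<Oplus>j\<in>J. a j \<otimes> r j | J r. finite J \<and> J \<subseteq> T \<and> r \<in> J \<rightarrow> carrier R}"
  shows "right_ideal I R" and "\<And>j. j \<in> T \<Longrightarrow> a j \<in> I"
proof -
  have ac: "a j \<in> carrier R" if "j \<in> T" for j using a that by auto
  have mem: "(\<Oplus>j\<in>J. a j \<otimes> r j) \<in> I" if "finite J" "J \<subseteq> T" "r \<in> J \<rightarrow> carrier R" for J r
    using that unfolding I_def by blast
  show "a j \<in> I" if "j \<in> T" for j
    using mem[of "{j}" "\<lambda>_. \<one>"] ac[OF that] that by simp
  show "right_ideal I R"
  proof (rule right_idealI)
    show "I \<subseteq> carrier R"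
    proof
      fix x assume "x \<in> I"
      then obtain J r where J: "finite J" "J \<subseteq> T" "r \<in> J \<rightarrow> carrier R"
          and x: "x = (\<Oplus>j\<in>J. a j \<otimes> r j)"
        unfolding I_def by blast
      have "a j \<in> carrier R" "r j \<in> carrier R" if "j \<in> J" for j using ac J that by auto
      then show "x \<in> carrier R" unfolding x by (intro finsum_closed) auto
    qed
    show "\<zero> \<in> I" using mem[of "{}"] by simp
  next
    fix x y assume "x \<in> I" "y \<in> I"
    then obtain J r K s where J: "finite J" "J \<subseteq> T" "r \<in> J \<rightarrow> carrier R"
        and K: "finite K" "K \<subseteq> T" "s \<in> K \<rightarrow> carrier R"
        and xy: "x = (\<Oplus>j\<in>J. a j \<otimes> r j)" "y = (\<Oplus>j\<in>K. a j \<otimes> s j)"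
      unfolding I_def by blast
    \<comment> \<open>Extension by zero puts both combinations on the common index set
      \<open>J \<union> K\<close>.\<close>
    define r' where "r' j = (if j \<in> J then r j else \<zero>)" for j
    define s' where "s' j = (if j \<in> K then s j else \<zero>)" for j
    have c: "r' j \<in> carrier R" "s' j \<in> carrier R" for j
      using J K by (auto simp: r'_def s'_def)
    have aJK: "a j \<in> carrier R" if "j \<in> J \<union> K" for j using ac J K that by blast
    have "x = (\<Oplus>j\<in>J. a j \<otimes> r' j)"
      unfolding xy using aJK c by (intro finsum_cong') (auto simp: r'_def)
    also have "\<dots> = (\<Oplus>j\<in>J \<union> K. a j \<otimes> r' j)"
      using J K aJK c by (intro finsum_mono_neutral) (auto simp: r'_def)
    finally have x: "x = (\<Oplus>j\<in>J \<union> K. a j \<otimes> r' j)" .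
    have "y = (\<Oplus>j\<in>K. a j \<otimes> s' j)"
      unfolding xy using aJK c by (intro finsum_cong') (auto simp: s'_def)
    also have "\<dots> = (\<Oplus>j\<in>J \<union> K. a j \<otimes> s' j)"
      using J K aJK c by (intro finsum_mono_neutral) (auto simp: s'_def)
    finally have y: "y = (\<Oplus>j\<in>J \<union> K. a j \<otimes> s' j)" .
    have "x \<oplus> y = (\<Oplus>j\<in>J \<union> K. a j \<otimes> r' j \<oplus> a j \<otimes> s' j)"
      unfolding x y using aJK c by (intro finsum_addf[symmetric]) auto
    also have "\<dots> = (\<Oplus>j\<in>J \<union> K. a j \<otimes> (r' j \<oplus> s' j))"
      using aJK c by (intro finsum_cong') (auto simp: r_distr)
    finally show "x \<oplus> y \<in> I" using mem[of "J \<union> K" "\<lambda>j. r' j \<oplus> s' j"] J K c by auto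
  next
    fix x b assume "x \<in> I" and b: "b \<in> carrier R"
    then obtain J r where J: "finite J" "J \<subseteq> T" "r \<in> J \<rightarrow> carrier R"
        and x: "x = (\<Oplus>j\<in>J. a j \<otimes> r j)"
      unfolding I_def by blast
    have aJ: "a j \<in> carrier R" "r j \<in> carrier R" if "j \<in> J" for j using ac J that by auto
    have "x \<otimes> b = (\<Oplus>j\<in>J. a j \<otimes> r j \<otimes> b)"
      unfolding x using aJ J b by (intro finsum_ldistr) auto
    also have "\<dots> = (\<Oplus>j\<in>J. a j \<otimes> (r j \<otimes> b))"
      using aJ b by (intro finsum_cong') (auto simp: m_assoc)
    finally show "x \<otimes> b \<in> I" using mem[of J "\<lambda>j. r j \<otimes> b"] J aJ b by auto
  qed
qed

lemma ideal_finsum_closed: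
  assumes "ideal I R" "finite S" "p \<in> S \<rightarrow> I"
  shows "(\<Oplus>i\<in>S. p i) \<in> I"
proof -
  interpret ideal I R by fact
  show ?thesis using assms(2,3)
  proof (induction S rule: finite_induct)
    case (insert i S)
    then have "p i \<in> I" "p \<in> S \<rightarrow> I" by auto
    moreover from this have "p i \<in> carrier R" "p \<in> S \<rightarrow> carrier R" using a_subset by blast+
    ultimately show ?case using insert by simp
  qed simp
qed

lemma right_ideal_Union_chain:
  assumes ne: "\<C> \<noteq> {}" and chain: "subset.chain {I. right_ideal I R} \<C>"
  shows "right_ideal (\<Union>\<C>) R"
proof (rule right_idealI)
  have ri: "right_ideal I R" if "I \<in> \<C>" for I
    using chain that by (auto simp: subset_chain_def)
  then have sg: "additive_subgroup I R" if "I \<in> \<C>" for I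
    using that by (simp add: right_ideal_def)
  show "\<Union>\<C> \<subseteq> carrier R" using sg additive_subgroup.a_subset by blast
  show "\<zero> \<in> \<Union>\<C>" using ne sg additive_subgroup.zero_closed by blast
  show "x \<otimes> a \<in> \<Union>\<C>" if "x \<in> \<Union>\<C>" "a \<in> carrier R" for x a
    using that ri by (auto simp: right_ideal_def)
  fix x y assume "x \<in> \<Union>\<C>" "y \<in> \<Union>\<C>"
  then obtain I J where "I \<in> \<C>" "x \<in> I" "J \<in> \<C>" "y \<in> J" by blast
  moreover have "I \<subseteq> J \<or> J \<subseteq> I"
    using chain \<open>I \<in> \<C>\<close> \<open>J \<in> \<C>\<close> by (auto simp: subset_chain_def)
  ultimately obtain K where "K \<in> \<C>" "x \<in> K" "y \<in> K" by blast
  then show "x \<oplus> y \<in> \<Union>\<C>" using additive_subgroup.a_closed[OF sg] by (intro UnionI)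
qed

text \<open>A right ideal is proper exactly if it omits \<open>\<one>\<close>, and this condition
  survives unions of chains, so that Zorn's lemma applies.\<close>

lemma ex_maximal_right_ideal:
  assumes "right_ideal I R" "\<one> \<notin> I"
  obtains M where "right_ideal M R" "I \<subseteq> M" "\<one> \<notin> M"
    "\<And>N. \<lbrakk>right_ideal N R; M \<subseteq> N; \<one> \<notin> N\<rbrakk> \<Longrightarrow> N = M"
proof -
  let ?S = "{J. right_ideal J R \<and> I \<subseteq> J \<and> \<one> \<notin> J}"
  have "\<exists>M\<in>?S. \<forall>J\<in>?S. M \<subseteq> J \<longrightarrow> J = M"
  proof (rule subset_Zorn_nonempty)
    fix \<C> assume C: "\<C> \<noteq> {}" "subset.chain ?S \<C>"
    then have "subset.chain {I. right_ideal I R} \<C>" by (auto simp: subset_chain_def)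
    with C show "\<Union>\<C> \<in> ?S"
      by (auto simp: subset_chain_def intro!: right_ideal_Union_chain)
  qed (use assms in auto)
  then show ?thesis using that by (metis (mono_tags, lifting) mem_Collect_eq order_trans)
qed

text \<open>
  The quotient module is realised on chosen representatives of the cosets.
\<close>

lemma right_primitive_quotient:
  assumes M: "right_ideal M R" "\<one> \<notin> M"
    and max: "\<And>N. \<lbrakk>right_ideal N R; M \<subseteq> N; \<one> \<notin> N\<rbrakk> \<Longrightarrow> N = M"
    and core: "\<And>a. \<lbrakk>a \<in> carrier R; \<And>x. x \<in> carrier R \<Longrightarrow> x \<otimes> a \<in> M\<rbrakk> \<Longrightarrow> a = \<zero>"
  shows "right_primitive R"
proof -
  interpret M: additive_subgroup M R using M by (simp add: right_ideal_def)
  have Mr: "x \<otimes> a \<in> M" if "x \<in> M" "a \<in> carrier R" for x a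
    using M that by (simp add: right_ideal_def)
  have Mc: "x \<in> carrier R" if "x \<in> M" for x using that M.a_subset by blast
  have Mneg: "\<ominus> x \<in> M" if "x \<in> M" for x
    using Mr[OF that, of "\<ominus> \<one>"] Mc[OF that] by (simp add: r_minus)
  have Mminus: "x \<ominus> y \<in> M" if "x \<in> M" "y \<in> M" for x y
    using that Mneg by (simp add: minus_eq)
  define cl where "cl x = (SOME y. y \<in> carrier R \<and> y \<ominus> x \<in> M)" for x
  have cl: "cl x \<in> carrier R \<and> cl x \<ominus> x \<in> M" if "x \<in> carrier R" for x
    unfolding cl_def
    by (rule someI[of _ x]) (use that in \<open>simp add: minus_eq r_neg\<close>)
  then have cl_in [simp]: "cl x \<in> carrier R" if "x \<in> carrier R" for x using that by blast
  have cl_eqI: "cl x = cl y" if xy: "x \<in> carrier R" "y \<in> carrier R" "x \<ominus> y \<in> M" for x y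
  proof -
    have "z \<ominus> x \<in> M \<longleftrightarrow> z \<ominus> y \<in> M" if "z \<in> carrier R" for z
    proof -
      have "z \<ominus> y = (z \<ominus> x) \<oplus> (x \<ominus> y)" "z \<ominus> x = (z \<ominus> y) \<ominus> (x \<ominus> y)"
        using that xy by algebra+
      then show ?thesis using xy Mminus M.a_closed by metis
    qed
    \<comment> \<open>\<open>cl\<close> is a choice made from this predicate alone, so equal
      predicates already give equal representatives.\<close>
    then have "(\<lambda>z. z \<in> carrier R \<and> z \<ominus> x \<in> M) = (\<lambda>z. z \<in> carrier R \<and> z \<ominus> y \<in> M)"
      by auto
    then show ?thesis by (simp add: cl_def)
  qed
  have cl_eqD: "x \<ominus> y \<in> M" if "x \<in> carrier R" "y \<in> carrier R" "cl x = cl y" for x y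
  proof -
    have "x \<ominus> y = (cl y \<ominus> y) \<ominus> (cl x \<ominus> x)" using that cl_in by algebra
    then show ?thesis using that cl Mminus by metis
  qed
  have cl_add1: "cl (cl x \<oplus> y) = cl (x \<oplus> y)" if "x \<in> carrier R" "y \<in> carrier R" for x y
  proof (rule cl_eqI)
    have "(cl x \<oplus> y) \<ominus> (x \<oplus> y) = cl x \<ominus> x" using that cl_in by algebra
    then show "(cl x \<oplus> y) \<ominus> (x \<oplus> y) \<in> M" using cl that by simp
  qed (use that in auto)
  have cl_add2: "cl (x \<oplus> cl y) = cl (x \<oplus> y)" if "x \<in> carrier R" "y \<in> carrier R" for x y
    using cl_add1[of y x] that by (simp add: a_comm)
  have cl_mult: "cl (cl x \<otimes> a) = cl (x \<otimes> a)" if "x \<in> carrier R" "a \<in> carrier R" for x a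
  proof (rule cl_eqI)
    have "(cl x \<otimes> a) \<ominus> (x \<otimes> a) = (cl x \<ominus> x) \<otimes> a"
      using that by (simp add: minus_eq l_distr l_minus)
    then show "(cl x \<otimes> a) \<ominus> (x \<otimes> a) \<in> M" using cl that Mr by simp
  qed (use that in auto)
  have cl_zero: "cl x = cl \<zero> \<longleftrightarrow> x \<in> M" if "x \<in> carrier R" for x
    using cl_eqI[of x \<zero>] cl_eqD[of x \<zero>] that by (auto simp: minus_eq)
  define Q :: "('a, 'a) right_module" where
    "Q = \<lparr>carrier = cl ` carrier R, mult = undefined, one = undefined, zero = cl \<zero>,
          add = (\<lambda>x y. cl (x \<oplus> y)), ract = (\<lambda>x a. cl (x \<otimes> a))\<rparr>"
  have cQ: "carrier Q = cl ` carrier R" and zQ: "\<zero>\<^bsub>Q\<^esub> = cl \<zero>" by (simp_all add: Q_def)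
  have aQ: "cl x \<oplus>\<^bsub>Q\<^esub> cl y = cl (x \<oplus> y)" if "x \<in> carrier R" "y \<in> carrier R" for x y
    using that by (simp add: Q_def cl_add1 cl_add2)
  have rQ: "cl x \<lhd>\<^bsub>Q\<^esub> a = cl (x \<otimes> a)" if "x \<in> carrier R" "a \<in> carrier R" for x a
    using that by (simp add: Q_def cl_mult)
  have Q: "abelian_group Q"
  proof (rule abelian_groupI)
    fix x assume "x \<in> carrier Q"
    then obtain a where "a \<in> carrier R" "x = cl a" by (auto simp: cQ)
    then have "cl (\<ominus> a) \<oplus>\<^bsub>Q\<^esub> x = \<zero>\<^bsub>Q\<^esub>" by (simp add: aQ zQ l_neg)
    then show "\<exists>y\<in>carrier Q. y \<oplus>\<^bsub>Q\<^esub> x = \<zero>\<^bsub>Q\<^esub>" using \<open>a \<in> carrier R\<close> by (auto simp: cQ)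
  qed (auto simp: cQ zQ aQ a_ac)
  interpret Q: right_module R Q
    by (intro right_module.intro right_module_axioms.intro ring_axioms Q)
      (auto simp: cQ aQ rQ l_distr r_distr m_assoc)
  have "irreducible_right_module R Q"
    unfolding irreducible_right_module_def
  proof (intro conjI allI impI)
    show "right_module R Q" by (rule Q.right_module_axioms)
    have "cl \<one> \<noteq> cl \<zero>" using M cl_zero by simp
    then show "carrier Q \<noteq> {\<zero>\<^bsub>Q\<^esub>}" by (auto simp: cQ zQ)
    fix K assume K: "right_submodule K R Q"
    then have sg: "subgroup K (add_monoid Q)" by (simp add: right_submodule_def)
    have KQ: "K \<subseteq> carrier Q" using subgroup.subset[OF sg] by simp
    \<comment> \<open>The preimage of the submodule in the ring: it is a right ideal above
      \<open>M\<close>, so by maximality it is \<open>M\<close> unless it contains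
      \<open>\<one>\<close>.\<close>
    define N where "N = {x \<in> carrier R. cl x \<in> K}"
    have KN: "K = cl ` N" using KQ by (auto simp: N_def cQ)
    have N: "right_ideal N R"
    proof (rule right_idealI)
      show "\<zero> \<in> N" using subgroup.one_closed[OF sg] by (simp add: N_def zQ)
      show "x \<oplus> y \<in> N" if "x \<in> N" "y \<in> N" for x y
        using that subgroup.m_closed[OF sg, of "cl x" "cl y"] by (auto simp: N_def aQ)
      fix x a assume "x \<in> N" "a \<in> carrier R"
      then show "x \<otimes> a \<in> N"
        using K by (auto simp: N_def right_submodule_def simp flip: rQ)
    qed (auto simp: N_def)
    show "K = {\<zero>\<^bsub>Q\<^esub>} \<or> K = carrier Q"
    proof (cases "\<one> \<in> N")
      case True
      have "x \<in> N" if "x \<in> carrier R" for x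
      proof -
        have "\<one> \<otimes> x \<in> N" using N True that unfolding right_ideal_def by blast
        then show ?thesis using that by simp
      qed
      then have "N = carrier R" by (auto simp: N_def)
      then show ?thesis by (simp add: KN cQ)
    next
      case False
      have clM: "cl ` M = {cl \<zero>}"
        using M.zero_closed Mc cl_zero by blast
      moreover have "cl \<zero> \<in> K" using subgroup.one_closed[OF sg] by (simp add: zQ)
      ultimately have "cl ` M \<subseteq> K" by simp
      then have "M \<subseteq> N" using Mc by (auto simp: N_def)
      then have "N = M" using max N False by blast
      then have "K = {cl \<zero>}" using clM by (simp add: KN)
      then show ?thesis by (simp add: zQ)
    qed
  qed
  moreover have "faithful_right_module R Q"
    unfolding faithful_right_module_def
  proof (intro conjI ballI impI)
    fix a assume a: "a \<in> carrier R" "\<forall>m\<in>carrier Q. m \<lhd>\<^bsub>Q\<^esub> a = \<zero>\<^bsub>Q\<^esub>"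
    then have "x \<otimes> a \<in> M" if "x \<in> carrier R" for x
      using that cl_zero[of "x \<otimes> a"] by (auto simp: cQ rQ zQ)
    then show "a = \<zero>" using core a by blast
  qed (rule Q.right_module_axioms)
  ultimately show ?thesis by (rule right_primitiveI)
qed

text \<open>The annihilator \<open>?A\<close> of the quotient by a maximal \<open>M\<close> above
  \<open>I\<close> is a two-sided ideal inside \<open>M\<close>. If it contained some
  \<open>a\<close> other than zero, it would contain the corresponding \<open>e\<close>, and
  \<open>\<one> = (\<one> \<oplus> e) \<ominus> e\<close> would lie in \<open>M\<close>.\<close>

lemma right_primitive_criterion:
  assumes I: "right_ideal I R" "\<one> \<notin> I"
    and comax: "\<And>a. \<lbrakk>a \<in> carrier R; a \<noteq> \<zero>\<rbrakk> \<Longrightarrow> \<exists>e\<in>Idl {a}. \<one> \<oplus> e \<in> I"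
  shows "right_primitive R"
proof -
  obtain M where M: "right_ideal M R" "I \<subseteq> M" "\<one> \<notin> M"
    and max: "\<And>N. \<lbrakk>right_ideal N R; M \<subseteq> N; \<one> \<notin> N\<rbrakk> \<Longrightarrow> N = M"
    using ex_maximal_right_ideal[OF I] by metis
  interpret M: additive_subgroup M R using M by (simp add: right_ideal_def)
  have Mr: "x \<otimes> a \<in> M" if "x \<in> M" "a \<in> carrier R" for x a
    using M that by (simp add: right_ideal_def)
  let ?A = "{a \<in> carrier R. \<forall>x\<in>carrier R. x \<otimes> a \<in> M}"
  have "ideal ?A R"
  proof (rule idealI)
    show "subgroup ?A (add_monoid R)"
    proof (rule add.subgroupI)
      fix a assume "a \<in> ?A"
      then show "\<ominus> a \<in> ?A"
        using Mr[of _ "\<ominus> \<one>"] M.a_subset by (force simp: r_minus)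
    qed (auto simp: r_distr)
  qed (auto simp: m_assoc[symmetric] intro: Mr ring_axioms)
  have "a = \<zero>" if a: "a \<in> carrier R" "\<And>x. x \<in> carrier R \<Longrightarrow> x \<otimes> a \<in> M" for a
  proof (rule ccontr)
    assume "a \<noteq> \<zero>"
    then obtain e where e: "e \<in> Idl {a}" "\<one> \<oplus> e \<in> I" using comax a by blast
    have "Idl {a} \<subseteq> ?A" using \<open>ideal ?A R\<close> a by (intro genideal_minimal) auto
    then have ec: "e \<in> carrier R" and "\<one> \<otimes> e \<in> M" using e by auto
    then have "e \<in> M" by simp
    then have "e \<otimes> \<ominus> \<one> \<in> M" by (rule Mr) simp
    moreover have "\<one> \<oplus> e \<in> M" using e M by blast
    ultimately have "(\<one> \<oplus> e) \<oplus> (e \<otimes> \<ominus> \<one>) \<in> M"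
      by (rule M.a_closed[rotated])
    then show False using M ec by (simp add: r_minus a_assoc r_neg)
  qed
  then show ?thesis using right_primitive_quotient M max by blast
qed

end

section \<open>Free families\<close>

lemma lepoll_iff_ordLeq: "A \<lesssim> B \<longleftrightarrow> ordLeq3 (card_of A) (card_of B)"
  by (simp add: lepoll_def flip: card_of_ordLeq)

lemma infinite_times_lepoll:
  assumes "infinite D" "A \<lesssim> D" "B \<lesssim> D"
  shows "A \<times> B \<lesssim> D"
  using card_of_Sigma_ordLeq_infinite[of D A "\<lambda>_. B"] assms by (simp add: lepoll_iff_ordLeq)

lemma infinite_lists_lepoll:
  assumes "infinite D"
  shows "lists D \<lesssim> D"
proof -
  have len: "{xs \<in> lists D. length xs = n} \<lesssim> D" for n
  proof (induction n)
    case 0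
    have "{xs \<in> lists D. length xs = 0} = {[]}" by auto
    then show ?case using finite_lepoll_infinite[OF assms, of "{[] :: 'a list}"] by simp
  next
    case (Suc n)
    have "{xs \<in> lists D. length xs = Suc n}
        \<subseteq> (\<lambda>(x, xs). x # xs) ` (D \<times> {xs \<in> lists D. length xs = n})"
      by (auto simp: length_Suc_conv)
    then have "{xs \<in> lists D. length xs = Suc n} \<lesssim> D \<times> {xs \<in> lists D. length xs = n}"
      by (rule subset_image_lepoll)
    also have "\<dots> \<lesssim> D" using assms Suc by (intro infinite_times_lepoll) auto
    finally show ?case .
  qed
  have "(\<Union>n::nat. {xs \<in> lists D. length xs = n}) \<lesssim> D"
    using assms len unfolding lepoll_iff_ordLeq infinite_iff_card_of_nat
    by (intro card_of_UNION_ordLeq_infinite) (auto simp: infinite_iff_card_of_nat)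
  moreover have "lists D = (\<Union>n. {xs \<in> lists D. length xs = n})" by auto
  ultimately show ?thesis by simp
qed

text \<open>
  \<open>L g\<close> plays the role of the first letter of \<open>g\<close>: the condition says that
  every \<open>u k\<close> maps the elements which do not start with its inverse to elements which start
  with \<open>u k\<close>.
\<close>

definition free_family :: "('g, 'x) monoid_scheme \<Rightarrow> 'i set \<Rightarrow> ('i \<Rightarrow> 'g) \<Rightarrow> bool" where
  "free_family G I u \<longleftrightarrow> u \<in> I \<rightarrow> carrier G \<and>
     (\<exists>L :: 'g \<Rightarrow> ('i \<times> bool) option. \<forall>g\<in>carrier G. \<forall>k\<in>I.
        L g = Some (k, False) \<or> L (u k \<otimes>\<^bsub>G\<^esub> g) = Some (k, True))"

lemma free_family_reindex:
  assumes "free_family G I u" "inj_on f J" "f ` J \<subseteq> I"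
  shows "free_family G J (u \<circ> f)"
proof -
  obtain L where L: "\<And>g k. \<lbrakk>g \<in> carrier G; k \<in> I\<rbrakk> \<Longrightarrow>
      L g = Some (k, False) \<or> L (u k \<otimes>\<^bsub>G\<^esub> g) = Some (k, True)"
    using assms(1) unfolding free_family_def by blast
  \<comment> \<open>Letters outside the image of \<open>f\<close> get unspecified names, which is
    harmless: only the letters \<open>f k\<close> must be renamed to \<open>k\<close>.\<close>
  let ?L = "\<lambda>g. map_option (map_prod (the_inv_into J f) id) (L g)"
  have "?L g = Some (k, False) \<or> ?L ((u \<circ> f) k \<otimes>\<^bsub>G\<^esub> g) = Some (k, True)"
    if "g \<in> carrier G" "k \<in> J" for g k
  proof -
    have "f k \<in> I" "the_inv_into J f (f k) = k"
      using that assms(2,3) by (auto simp: the_inv_into_f_f)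
    then show ?thesis using L[of g "f k"] that(1) by auto
  qed
  moreover have "u \<circ> f \<in> J \<rightarrow> carrier G"
    using assms by (force simp: free_family_def)
  ultimately show ?thesis
    unfolding free_family_def by (intro conjI exI[of _ ?L] ballI)
qed

text \<open>Left multiplication by \<open>H\<close> preserves every coset \<open>H #> g\<close>, and
  dividing by a representative on the right identifies the coset with \<open>H\<close> compatibly
  with this action. So the first-letter function on \<open>H\<close> can be copied to each coset.
  The representative is chosen from the coset alone, hence \<open>g\<close> and
  \<open>u k \<otimes> g\<close> share it.\<close>

lemma (in group) free_family_subgroup:
  assumes H: "subgroup H G" and u: "free_family (G\<lparr>carrier := H\<rparr>) I u"
  shows "free_family G I u"
proof -
  obtain L where L: "\<And>g k. \<lbrakk>g \<in> H; k \<in> I\<rbrakk> \<Longrightarrow>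
      L g = Some (k, False) \<or> L (u k \<otimes> g) = Some (k, True)"
    using u unfolding free_family_def by auto
  have uH: "u k \<in> H" if "k \<in> I" for k using u that by (auto simp: free_family_def)
  have Hc: "H \<subseteq> carrier G" by (rule subgroup.subset[OF H])
  define rep where "rep g = (SOME x. x \<in> H #> g)" for g
  have rep: "rep g \<in> H #> g" if "g \<in> carrier G" for g
    unfolding rep_def using rcos_self[OF that H] by (rule someI)
  have rc: "rep g \<in> carrier G" if "g \<in> carrier G" for g
    using rep[OF that] r_coset_subset_G[OF Hc that] by blast
  have quot: "g \<otimes> inv (rep g) \<in> H" if g: "g \<in> carrier G" for g
  proof -
    obtain h where h: "h \<in> H" "rep g = h \<otimes> g" using rep[OF g] by (auto simp: r_coset_def)
    then have "h \<in> carrier G" using Hc by blast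
    then have "g \<otimes> inv (rep g) = inv h"
      using g h by (simp add: inv_mult_group m_assoc[symmetric])
    then show ?thesis using subgroup.m_inv_closed[OF H h(1)] by simp
  qed
  let ?L = "\<lambda>g. L (g \<otimes> inv (rep g))"
  have "?L g = Some (k, False) \<or> ?L (u k \<otimes> g) = Some (k, True)"
    if g: "g \<in> carrier G" and k: "k \<in> I" for g k
  proof -
    have ukc: "u k \<in> carrier G" using uH[OF k] Hc by blast
    have "H #> (u k \<otimes> g) = H #> g"
      using coset_mult_assoc[OF Hc ukc g] coset_join2[OF ukc H uH[OF k]] by simp
    then have "rep (u k \<otimes> g) = rep g" by (simp add: rep_def)
    then show ?thesis
      using L[OF quot[OF g] k] g ukc rc[OF g] by (simp add: m_assoc)
  qed
  moreover have "u \<in> I \<rightarrow> carrier G" using uH Hc by auto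
  ultimately show ?thesis
    unfolding free_family_def by (intro conjI exI[of _ ?L] ballI)
qed

section \<open>Words and conjugates of free generators\<close>

lemma word_value_Nil [simp]: "word_value G [] = \<one>\<^bsub>G\<^esub>"
  by (simp add: word_value_def)

lemma word_value_Cons [simp]:
  "word_value G ((s, e) # w) = (if e then s else inv\<^bsub>G\<^esub> s) \<otimes>\<^bsub>G\<^esub> word_value G w"
  by (simp add: word_value_def)

context group
begin

lemma word_value_closed [simp]:
  "w \<in> lists (carrier G \<times> UNIV) \<Longrightarrow> word_value G w \<in> carrier G"
  by (induction w) auto

lemma word_value_append:
  "\<lbrakk>v \<in> lists (carrier G \<times> UNIV); w \<in> lists (carrier G \<times> UNIV)\<rbrakk> \<Longrightarrow>
    word_value G (v @ w) = word_value G v \<otimes> word_value G w"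
proof (induction v)
  case (Cons l v)
  then have "word_value G v \<in> carrier G" "word_value G w \<in> carrier G" by simp_all
  then show ?case using Cons by (cases l) (auto simp: m_assoc)
qed auto

lemma word_value_inverse:
  "w \<in> lists (carrier G) \<Longrightarrow>
    word_value G (map (\<lambda>s. (s, False)) (rev w)) = inv (word_value G (map (\<lambda>s. (s, True)) w))"
proof (induction w)
  case (Cons s w)
  have "map (\<lambda>s. (s, False)) (rev w) \<in> lists (carrier G \<times> UNIV)"
    "map (\<lambda>s. (s, True)) w \<in> lists (carrier G \<times> UNIV)"
    using Cons.prems by auto
  with Cons show ?case by (simp add: word_value_append inv_mult_group)
qed simp

text \<open>All elements are powers of \<open>y\<close>. In contrapositive form this shows that a
  non-abelian free group has at least two free generators.\<close>

lemma word_value_powers_comm_group: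
  assumes y: "y \<in> carrier G" and gen: "carrier G \<subseteq> word_value G ` lists ({y} \<times> UNIV)"
  shows "comm_group G"
proof -
  have pow: "\<exists>i::int. word_value G w = y [^] i" if "w \<in> lists ({y} \<times> UNIV)" for w
    using that
  proof (induction w)
    case Nil
    show ?case by (auto intro!: exI[of _ 0])
  next
    case (Cons l w)
    then obtain i :: int where i: "word_value G w = y [^] i" by auto
    obtain e where l: "l = (y, e)" using Cons by auto
    show ?case
    proof (cases e)
      case True
      then show ?thesis
        using y i l by (auto simp: int_pow_mult intro!: exI[of _ "1 + i"])
    next
      case False
      then show ?thesis
        using y i l int_pow_mult[of y "- 1" i] by (auto simp: int_pow_neg intro!: exI[of _ "- 1 + i"])
    qed
  qed
  have "a \<otimes> b = b \<otimes> a" if ab: "a \<in> carrier G" "b \<in> carrier G" for a b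
  proof -
    have gen_pow: "\<exists>i::int. x = y [^] i" if "x \<in> carrier G" for x
      using that gen pow by blast
    obtain i j :: int where "a = y [^] i" "b = y [^] j"
      using gen_pow[OF ab(1)] gen_pow[OF ab(2)] by blast
    then show ?thesis using y by (simp add: int_pow_mult[symmetric] add.commute)
  qed
  then show ?thesis by (rule group_comm_groupI)
qed

text \<open>
  Conjugation makes infinitely many free elements out of two free generators.  Here \<open>L g\<close> reads
  off the word \<open>w\<close> and the sign of the first letter \<open>y\<close> or its inverse, if the reduced word of
  \<open>g\<close> starts with \<open>w\<close> followed by this letter.
\<close>

lemma free_family_conjugates:
  assumes S: "S \<subseteq> carrier G" and bij: "bij_betw (word_value G) (reduced_words S) (carrier G)"
    and y: "y \<in> S"
  shows "free_family G (lists (S - {y}))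
    (\<lambda>w. word_value G (map (\<lambda>s. (s, True)) w @ (y, True) # map (\<lambda>s. (s, False)) (rev w)))"
    (is "free_family G ?D ?u")
proof -
  let ?pos = "map (\<lambda>s. (s, True))" and ?neg = "\<lambda>w. map (\<lambda>s. (s, False)) (rev w)"
  let ?P = "\<lambda>(s :: 'a, e :: bool) (t, d). \<not> (s = t \<and> e \<noteq> d)"
  define word where "word g = the_inv_into (reduced_words S) (word_value G) g" for g
  have word: "word g \<in> reduced_words S" "word_value G (word g) = g" if "g \<in> carrier G" for g
    using bij that unfolding word_def bij_betw_def
    by (auto intro: the_inv_into_into f_the_inv_into_f)
  have word_eq: "word (word_value G z) = z" if "z \<in> reduced_words S" for z
    using bij that unfolding word_def bij_betw_def by (auto intro: the_inv_into_f_f)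
  have letters: "z \<in> lists (carrier G \<times> UNIV)" if "z \<in> lists (S \<times> UNIV)" for z
    using that S by auto
  have posL: "?pos w \<in> lists (S \<times> UNIV)" and negL: "?neg w \<in> lists (S \<times> UNIV)"
    if "w \<in> lists S" for w using that by auto
  have pos_red: "successively ?P (?pos w)" for w by (induction w rule: induct_list012) auto
  have neg_red: "successively ?P (?neg w)" for w
    unfolding rev_map[symmetric] successively_rev
    by (induction w rule: induct_list012) auto
  define L where "L g =
    (case dropWhile (\<lambda>(s, e). s \<noteq> y \<and> e) (word g) of
       [] \<Rightarrow> None
     | (s, e) # q \<Rightarrow>
         if s = y then Some (map fst (takeWhile (\<lambda>(s, e). s \<noteq> y \<and> e) (word g)), e) else None)"
    for g
  have L: "L g = Some (w, e)" if "word g = ?pos w @ (y, e) # q" "w \<in> ?D" for g w e q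
  proof -
    have "\<forall>l\<in>set (?pos w). case l of (s, e) \<Rightarrow> s \<noteq> y \<and> e" using that(2) by auto
    then have "dropWhile (\<lambda>(s, e). s \<noteq> y \<and> e) (word g) = (y, e) # q"
      "takeWhile (\<lambda>(s, e). s \<noteq> y \<and> e) (word g) = ?pos w"
      using that(1) by (auto simp: dropWhile_append takeWhile_append)
    then show ?thesis by (simp add: L_def comp_def)
  qed
  have "L g = Some (w, False) \<or> L (?u w \<otimes> g) = Some (w, True)"
    if g: "g \<in> carrier G" and w: "w \<in> ?D" for g w
  proof (cases "L g = Some (w, False)")
    case False
    \<comment> \<open>Multiplication by \<open>?u w\<close> cancels exactly the letters that
      \<open>w\<close> and the word of \<open>g\<close> share at the front. The longest common
      prefix therefore tells what survives, namely the word \<open>?z\<close> below.\<close>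
    obtain p' v q where p': "?pos w = p' @ v" "word g = p' @ q"
      and diff: "v = [] \<or> q = [] \<or> hd v \<noteq> hd q"
      using longest_common_prefix[of "?pos w" "word g"] by blast
    then obtain p w' where w': "w = p @ w'" "p' = ?pos p" "v = ?pos w'"
      by (metis map_eq_append_conv)
    have wS: "w \<in> lists S" "p \<in> lists S" "w' \<in> lists S" and w'D: "w' \<in> ?D"
      using w w'(1) by auto
    have red: "word g \<in> lists (S \<times> UNIV)" "successively ?P (word g)"
      using word(1)[OF g] by (auto simp: reduced_words_def)
    then have qS: "q \<in> lists (S \<times> UNIV)" and qred: "successively ?P q"
      using p' by (auto simp: successively_append_iff)
    let ?z = "?pos w @ (y, True) # ?neg w' @ q"
    \<comment> \<open>The critical junction is the one in front of \<open>q\<close>. If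
      \<open>w'\<close> is empty, \<open>q\<close> cannot start with the inverse of
      \<open>y\<close>, because \<open>L g\<close> is not \<open>Some (w, False)\<close>. Otherwise
      the letter before \<open>q\<close> is the inverse of the first letter of \<open>w'\<close>,
      and \<open>q\<close> does not start with that first letter by maximality of the common
      prefix.\<close>
    have 1: "successively ?P ((y, True) # ?neg w' @ q)"
    proof (cases "w' = []")
      case True
      have "q = [] \<or> hd q \<noteq> (y, False)"
      proof (rule ccontr)
        assume "\<not> ?thesis"
        then obtain q' where "q = (y, False) # q'" by (cases q) auto
        then have "word g = ?pos w @ (y, False) # q'" using p'(2) w' True by simp
        then show False using L w False by blast
      qed
      then show ?thesis using True qred by (cases q) (auto split: prod.splits)
    next
      case nonempty: False
      then obtain a b where ab: "w' = a # b" by (cases w') auto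
      have "q = [] \<or> hd q \<noteq> (a, True)" using diff w' ab by auto
      then have "successively ?P (?neg w' @ q)"
        using neg_red[of w'] qred ab by (cases q) (auto simp: successively_append_iff)
      moreover obtain c d where cd: "rev w' = c # d" using nonempty by (cases "rev w'") auto
      moreover have "c \<noteq> y"
      proof -
        have "c \<in> set w'" using cd by (metis list.set_intros(1) set_rev)
        then show ?thesis using w'D by auto
      qed
      ultimately show ?thesis by auto
    qed
    have "w = [] \<or> last w \<noteq> y" using w by (auto simp: last_in_set dest!: in_listsD)
    then have "successively ?P ?z"
      using pos_red[of w] 1 by (auto simp: successively_append_iff last_map)
    moreover have "?z \<in> lists (S \<times> UNIV)"
      using posL[OF wS(1)] negL[OF wS(3)] qS y by auto
    ultimately have zred: "?z \<in> reduced_words S" by (simp add: reduced_words_def)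
    note cl = letters[OF posL[OF wS(1)]] letters[OF posL[OF wS(2)]] letters[OF posL[OF wS(3)]]
      letters[OF negL[OF wS(1)]] letters[OF negL[OF wS(2)]] letters[OF negL[OF wS(3)]]
      letters[OF qS]
    have yc: "y \<in> carrier G" using y S by blast
    have pS: "p \<in> lists (carrier G)" using wS(2) S by auto
    have "word_value G (?neg p) \<otimes> word_value G (word g) = word_value G q"
      using cl word_value_inverse[OF pS] p'(2) w'(2)
      by (simp add: word_value_append m_assoc[symmetric])
    moreover have "?neg w = ?neg w' @ ?neg p" using w'(1) by simp
    ultimately have "word_value G (?neg w) \<otimes> g = word_value G (?neg w' @ q)"
      using cl word(2)[OF g] g by (simp add: word_value_append m_assoc)
    then have "?u w \<otimes> g = word_value G ?z"
      using cl yc g by (simp add: word_value_append m_assoc del: map_append)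
    then have "word (?u w \<otimes> g) = ?z" using word_eq[OF zred] by simp
    then show ?thesis using L w by blast
  qed simp
  moreover have "?u \<in> ?D \<rightarrow> carrier G"
  proof
    fix w assume "w \<in> ?D"
    then have "?pos w @ (y, True) # ?neg w \<in> lists (carrier G \<times> UNIV)"
      using y S by auto
    then show "?u w \<in> carrier G" by (rule word_value_closed)
  qed
  ultimately show ?thesis unfolding free_family_def by blast
qed

end

text \<open>The conjugates of \<open>y\<close> by words in the other generators form a basis of the
  normal closure of \<open>y\<close>; those by positive words are already numerous enough. For
  finite \<open>S\<close> the group is countable and the index set infinite; for infinite
  \<open>S\<close> both have the cardinality of \<open>S\<close>.\<close>

lemma free_group_imp_free_family:
  assumes G: "free_group G" "\<not> comm_group G"
  obtains D :: "'g list set" and u :: "'g list \<Rightarrow> 'g"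
  where "infinite D" "carrier G \<lesssim> D" "free_family G D u"
proof -
  interpret group G using G by (simp add: free_group_def)
  obtain S where S: "S \<subseteq> carrier G"
    and bij: "bij_betw (word_value G) (reduced_words S) (carrier G)"
    using G by (auto simp: free_group_def)
  have red: "reduced_words S \<subseteq> lists (S \<times> UNIV)" by (auto simp: reduced_words_def)
  have not_single: "\<not> S \<subseteq> {y}" if "y \<in> carrier G" for y
  proof
    assume "S \<subseteq> {y}"
    then have "lists (S \<times> UNIV) \<subseteq> lists ({y} \<times> UNIV :: ('g \<times> bool) set)"
      by (intro lists_mono) auto
    then have "carrier G \<subseteq> word_value G ` lists ({y} \<times> UNIV)"
      using bij red unfolding bij_betw_def by blast
    then show False using G word_value_powers_comm_group[OF that] by blast
  qed
  \<comment> \<open>Applied to the neutral element, \<open>not_single\<close> yields that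
    \<open>S\<close> is nonempty.\<close>
  obtain y where y: "y \<in> S" using not_single[OF one_closed] by blast
  obtain x where x: "x \<in> S" "x \<noteq> y" using not_single[of y] y S by blast
  let ?D = "lists (S - {y})"
  have "inj (\<lambda>n. replicate n x)" by (auto simp: inj_on_def)
  moreover have "range (\<lambda>n. replicate n x) \<subseteq> ?D" using x by auto
  ultimately have inf: "infinite ?D" using infinite_super range_inj_infinite by blast
  have "carrier G \<approx> reduced_words S" using bij eqpoll_def eqpoll_sym by blast
  also have "reduced_words S \<lesssim> lists (S \<times> (UNIV :: bool set))" using red by (rule subset_imp_lepoll)
  also have "\<dots> \<lesssim> ?D"
  proof (cases "finite S")
    case True
    then have "countable (lists (S \<times> (UNIV :: bool set)))"
      by (intro countable_lists countable_finite) auto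
    then have "lists (S \<times> (UNIV :: bool set)) \<lesssim> (UNIV :: nat set)"
      by (auto simp: countable_def lepoll_def)
    also have "\<dots> \<lesssim> ?D" using inf by (simp add: infinite_le_lepoll)
    finally show ?thesis .
  next
    case False
    then have inf': "infinite (S - {y})" by simp
    have "S \<lesssim> S - {y}"
      using infinite_insert_eqpoll[OF inf', of y] y
      by (simp add: insert_absorb eqpoll_imp_lepoll)
    then have "S \<times> (UNIV :: bool set) \<lesssim> S - {y}"
      using finite_lepoll_infinite[OF inf', of "UNIV :: bool set"] by (intro infinite_times_lepoll[OF inf']) simp_all
    then show ?thesis by (rule lists_lepoll_mono)
  qed
  finally show ?thesis
    using that[OF inf _ free_family_conjugates[OF S bij y]] by blast
qed

section \<open>Counting in the Cayley forest, and translates from PHP\<close>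

context group
begin

text \<open>
  The edges from \<open>z\<close> to \<open>u k \<otimes> z\<close> form a forest, so there are at most as many of them as
  vertices: orient each edge towards its end with the longer word.
\<close>

lemma free_family_card_edges:
  assumes u: "free_family G I u" and K: "finite K" "K \<subseteq> I"
    and Z: "\<And>k. k \<in> K \<Longrightarrow> finite (Z k)" "\<And>k. k \<in> K \<Longrightarrow> Z k \<subseteq> carrier G"
  shows "(\<Sum>k\<in>K. card (Z k)) \<le> card ((\<Union>k\<in>K. Z k) \<union> (\<Union>k\<in>K. (\<lambda>z. u k \<otimes> z) ` Z k))"
proof -
  obtain L where L: "\<And>g k. \<lbrakk>g \<in> carrier G; k \<in> I\<rbrakk> \<Longrightarrow>
      L g = Some (k, False) \<or> L (u k \<otimes> g) = Some (k, True)"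
    using u unfolding free_family_def by blast
  have uc: "u k \<in> carrier G" if "k \<in> K" for k using u K that by (auto simp: free_family_def)
  let ?e = "\<lambda>(k, z). if L z = Some (k, False) then z else u k \<otimes> z"
  \<comment> \<open>The first letter of the chosen end reveals both the label \<open>k\<close> and
    which end was chosen, so the edge can be recovered from it.\<close>
  have Le: "L (?e (k, z)) = Some (k, L z \<noteq> Some (k, False))" if "k \<in> K" "z \<in> Z k" for k z
    using L[of z k] Z that K by auto
  have "inj_on ?e (Sigma K Z)"
  proof (rule inj_onI)
    fix p q assume pq: "p \<in> Sigma K Z" "q \<in> Sigma K Z" "?e p = ?e q"
    then obtain k z k' z' where p: "p = (k, z)" "q = (k', z')"
      and *: "k \<in> K" "z \<in> Z k" "k' \<in> K" "z' \<in> Z k'" by auto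
    then have eq: "?e (k, z) = ?e (k', z')" using pq by simp
    have "Some (k, L z \<noteq> Some (k, False)) = Some (k', L z' \<noteq> Some (k', False))"
      using Le[OF *(1,2)] Le[OF *(3,4)] by (simp only: eq)
    then have k: "k' = k" and "L z' = Some (k, False) \<longleftrightarrow> L z = Some (k, False)" by auto
    then have "z = z' \<or> u k \<otimes> z = u k \<otimes> z'" using eq by (auto split: if_splits)
    moreover have "z \<in> carrier G" "z' \<in> carrier G" using * Z by blast+
    ultimately show "p = q" using k p uc[OF *(1)] by auto
  qed
  then have "card (Sigma K Z) \<le> card ((\<Union>k\<in>K. Z k) \<union> (\<Union>k\<in>K. (\<lambda>z. u k \<otimes> z) ` Z k))"
  proof (rule card_inj_on_le)
    show "?e ` Sigma K Z \<subseteq> (\<Union>k\<in>K. Z k) \<union> (\<Union>k\<in>K. (\<lambda>z. u k \<otimes> z) ` Z k)"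
    proof
      fix h assume "h \<in> ?e ` Sigma K Z"
      then obtain k z where "k \<in> K" "z \<in> Z k" "h = z \<or> h = u k \<otimes> z" by auto
      then show "h \<in> (\<Union>k\<in>K. Z k) \<union> (\<Union>k\<in>K. (\<lambda>z. u k \<otimes> z) ` Z k)" by blast
    qed
    show "finite ((\<Union>k\<in>K. Z k) \<union> (\<Union>k\<in>K. (\<lambda>z. u k \<otimes> z) ` Z k))" using K Z by simp
  qed
  then show ?thesis using K Z by (simp add: card_SigmaI)
qed

text \<open>Let \<open>E\<close> be the number of edges, \<open>T\<close> the set of tails and
  \<open>H\<close> the set of heads. If each head outside \<open>S\<close> were hit twice, then
  \<open>2 |H - S| \<le> E\<close>, while the forest bound gives
  \<open>E \<le> |T| + |H - S| + |S|\<close>. Together \<open>E \<le> 2 |T| + 2 |S|\<close>,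
  contrary to \<open>many\<close>.\<close>

lemma free_family_lonely_edge:
  assumes u: "free_family G I u" and K: "finite K" "K \<subseteq> I"
    and Z: "\<And>k. k \<in> K \<Longrightarrow> finite (Z k)" "\<And>k. k \<in> K \<Longrightarrow> Z k \<subseteq> carrier G"
    and S: "finite S"
    and many: "2 * card (\<Union>k\<in>K. Z k) + 2 * card S < (\<Sum>k\<in>K. card (Z k))"
  obtains k z where "k \<in> K" "z \<in> Z k" "u k \<otimes> z \<notin> S"
    "\<And>k'. \<lbrakk>k' \<in> K; k' \<noteq> k\<rbrakk> \<Longrightarrow> inv (u k') \<otimes> (u k \<otimes> z) \<notin> Z k'"
proof -
  have uc: "u k \<in> carrier G" if "k \<in> K" for k using u K that by (auto simp: free_family_def)
  define H where "H = (\<Union>k\<in>K. (\<lambda>z. u k \<otimes> z) ` Z k)"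
  define deg where "deg h = {k \<in> K. inv (u k) \<otimes> h \<in> Z k}" for h
  have finH: "finite H" using K Z by (simp add: H_def)
  have fin: "finite (deg h)" for h using K by (simp add: deg_def)
  have "\<exists>h\<in>H - S. card (deg h) < 2"
  proof (rule ccontr)
    assume "\<not> ?thesis"
    then have two: "2 \<le> card (deg h)" if "h \<in> H - S" for h using that by force
    have "2 * card (H - S) = (\<Sum>h\<in>H - S. 2)" by simp
    also have "\<dots> \<le> (\<Sum>h\<in>H - S. card (deg h))" using two by (rule sum_mono)
    also have "\<dots> = card (Sigma (H - S) deg)" using finH fin by (simp add: card_SigmaI)
    also have "\<dots> \<le> card (Sigma K Z)"
    proof (rule card_inj_on_le)
      let ?f = "\<lambda>(h, k). (k, inv (u k) \<otimes> h)"
      have "H \<subseteq> carrier G" using uc Z by (auto simp: H_def subset_iff)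
      then show "inj_on ?f (Sigma (H - S) deg)"
        using uc by (auto simp: inj_on_def deg_def subset_iff)
      show "?f ` Sigma (H - S) deg \<subseteq> Sigma K Z" by (auto simp: deg_def)
      show "finite (Sigma K Z)" using K Z by auto
    qed
    finally have 1: "2 * card (H - S) \<le> (\<Sum>k\<in>K. card (Z k))"
      using K Z by (simp add: card_SigmaI)
    have "(\<Sum>k\<in>K. card (Z k)) \<le> card ((\<Union>k\<in>K. Z k) \<union> H)"
      unfolding H_def using u K Z by (rule free_family_card_edges)
    also have "\<dots> \<le> card ((\<Union>k\<in>K. Z k) \<union> (H - S) \<union> S)"
      using finH S K Z by (intro card_mono) auto
    also have "\<dots> \<le> card (\<Union>k\<in>K. Z k) + card (H - S) + card S"
      using card_Un_le by (meson add_mono le_refl order_trans)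
    finally show False using 1 many by linarith
  qed
  then obtain h where h: "h \<in> H" "h \<notin> S" "card (deg h) < 2" by blast
  then obtain k z where k: "k \<in> K" "z \<in> Z k" "h = u k \<otimes> z" by (auto simp: H_def)
  have "inv (u k) \<otimes> h = z" using k uc Z by (auto simp: m_assoc[symmetric] subset_iff)
  then have "k \<in> deg h" using k by (simp add: deg_def)
  have "k' = k" if "k' \<in> K" "inv (u k') \<otimes> h \<in> Z k'" for k'
  proof (rule ccontr)
    assume "k' \<noteq> k"
    then have "card {k, k'} = 2" by simp
    moreover have "card {k, k'} \<le> card (deg h)"
      using fin by (rule card_mono) (use \<open>k \<in> deg h\<close> that in \<open>simp add: deg_def\<close>)
    ultimately show False using h(3) by linarith
  qed
  then show ?thesis using that[OF k(1,2)] h(2) unfolding k(3) by blast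
qed

text \<open>Membership of \<open>x\<close> in the translate of the complement of \<open>C i\<close>
  by the inverse of \<open>t i\<close> means \<open>t i \<otimes> x \<notin> C i\<close>, so every
  \<open>x\<close> is carried into \<open>C i\<close> by most \<open>t i\<close>. The bound is
  relaxed by \<open>sqrt n \<le> n\<close>, and \<open>m\<close> lets a caller ask for many
  translates.\<close>

lemma PHP_sparse:
  assumes "PHP G" "F \<subseteq> carrier G" "finite F" "(\<epsilon> :: real) > 0"
  shows "\<exists>(n :: nat) t C. m \<le> n \<and> 1 \<le> n \<and>
    (\<forall>i\<in>{1..n}. t i \<in> carrier G \<and> disjoint_family_on (\<lambda>a. a <# C i) F) \<and>
    (\<forall>x\<in>carrier G. real (card {i \<in> {1..n}. t i \<otimes> x \<notin> C i}) \<le> \<epsilon> * real n)"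
proof -
  obtain N where N: "\<And>n :: nat. N \<le> n \<Longrightarrow> \<exists>(t :: nat \<Rightarrow> 'a) (C :: nat \<Rightarrow> 'a set) (D :: nat \<Rightarrow> 'a set).
        (\<forall>i\<in>{1..n}. t i \<in> carrier G \<and> C i \<subseteq> D i \<and> D i \<subseteq> carrier G) \<and>
        disjoint_family_on
          (case_sum (\<lambda>(a, i). a <# C i)
                    (\<lambda>(a, i). (a \<otimes> inv (t i)) <# (carrier G - D i)))
          ((F \<times> {1..n}) <+> (F \<times> {1..n})) \<and>
        (\<forall>x\<in>carrier G.
          real (card ({i \<in> {1..n}. x \<in> D i} \<union>
                      {i \<in> {1..n}. x \<in> inv (t i) <# (carrier G - C i)}))
            \<le> \<epsilon> * sqrt (real n))"
    using assms unfolding PHP_def by blast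
  define n where "n = max N (max m 1)"
  obtain t :: "nat \<Rightarrow> 'a" and C D :: "nat \<Rightarrow> 'a set" where
    t: "\<forall>i\<in>{1..n}. t i \<in> carrier G \<and> C i \<subseteq> D i \<and> D i \<subseteq> carrier G"
    and disj: "disjoint_family_on
          (case_sum (\<lambda>(a, i). a <# C i)
                    (\<lambda>(a, i). (a \<otimes> inv (t i)) <# (carrier G - D i)))
          ((F \<times> {1..n}) <+> (F \<times> {1..n}))"
    and J: "\<forall>x\<in>carrier G. real (card ({i \<in> {1..n}. x \<in> D i} \<union>
                      {i \<in> {1..n}. x \<in> inv (t i) <# (carrier G - C i)}))
            \<le> \<epsilon> * sqrt (real n)"
    using N[of n] unfolding n_def by fastforce
  have "disjoint_family_on (\<lambda>a. a <# C i) F" if "i \<in> {1..n}" for i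
    unfolding disjoint_family_on_def
  proof (intro ballI impI)
    fix a b assume "a \<in> F" "b \<in> F" "a \<noteq> b"
    then have "Inl (a, i) \<in> (F \<times> {1..n}) <+> (F \<times> {1..n})"
      "Inl (b, i) \<in> (F \<times> {1..n}) <+> (F \<times> {1..n})" "Inl (a, i) \<noteq> Inl (b, i)"
      using that by auto
    from disjoint_family_onD[OF disj this] show "(a <# C i) \<inter> (b <# C i) = {}" by simp
  qed
  moreover have "real (card {i \<in> {1..n}. t i \<otimes> x \<notin> C i}) \<le> \<epsilon> * real n"
    if x: "x \<in> carrier G" for x
  proof -
    have "x \<in> inv (t i) <# (carrier G - C i)" if "i \<in> {1..n}" "t i \<otimes> x \<notin> C i" for i
    proof -
      have "t i \<in> carrier G" using t that by blast
      then have "x = inv (t i) \<otimes> (t i \<otimes> x)" "t i \<otimes> x \<in> carrier G - C i"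
        using x that by (simp_all add: m_assoc[symmetric])
      then show ?thesis unfolding l_coset_def by blast
    qed
    then have "card {i \<in> {1..n}. t i \<otimes> x \<notin> C i} \<le>
        card ({i \<in> {1..n}. x \<in> D i} \<union> {i \<in> {1..n}. x \<in> inv (t i) <# (carrier G - C i)})"
      by (intro card_mono) auto
    also have "real \<dots> \<le> \<epsilon> * sqrt (real n)" using J x by blast
    also have "\<dots> \<le> \<epsilon> * real n"
    proof -
      have "1 \<le> real n" by (simp add: n_def)
      then have "sqrt (real n) \<le> real n" by (intro real_le_lsqrt) (auto simp: power2_eq_square)
      then show ?thesis using assms(4) by simp
    qed
    finally show ?thesis by simp
  qed
  moreover have "m \<le> n" "1 \<le> n" by (auto simp: n_def)
  ultimately show ?thesis using t by (intro exI[of _ n] exI[of _ t] exI[of _ C]) simp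
qed

end

section \<open>Growth of supports\<close>

text \<open>With \<open>F\<close> and \<open>X\<close> the sizes of two supports, \<open>W\<close>
  the total size of the products and \<open>B\<close> the number of bad pairs, the loss
  \<open>2 F B\<close> is at most half of the main term \<open>n F X\<close>.\<close>

lemma half_bound:
  fixes n F X W B :: nat
  assumes "n * (F * X) \<le> W + 2 * F * B" "4 * B \<le> X * n"
  shows "n * (F * X) \<le> 2 * W"
proof -
  have "F * (4 * B) \<le> F * (X * n)" using assms(2) by (rule mult_le_mono2)
  moreover have "F * (4 * B) = 2 * (2 * F * B)" "F * (X * n) = n * (F * X)" by simp_all
  ultimately show ?thesis using assms(1) by linarith
qed

section \<open>Supports and coefficients in the group ring\<close>

locale group_algebra = R: ring R + G: group G
  for R :: "('r, 'y) ring_scheme" (structure) and G :: "('g, 'x) monoid_scheme"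
begin

abbreviation A :: "('g \<Rightarrow> 'r) ring" where "A \<equiv> group_ring R G"

definition supp :: "('g \<Rightarrow> 'r) \<Rightarrow> 'g set" where "supp f = {x \<in> carrier G. f x \<noteq> \<zero>}"

definition single :: "'g \<Rightarrow> 'r \<Rightarrow> 'g \<Rightarrow> 'r" where "single g k = (\<lambda>x. if x = g then k else \<zero>)"

sublocale A: ring A
  by (rule group_ring_is_ring) (rule R.ring_axioms, rule G.group_axioms)

lemma carrier_A_iff:
  "f \<in> carrier A \<longleftrightarrow> (\<forall>g\<in>carrier G. f g \<in> carrier R) \<and>
    (\<forall>g. g \<notin> carrier G \<longrightarrow> f g = \<zero>) \<and> finite (supp f)"
  by (simp add: group_ring_def supp_def)

lemma coeff_closed [simp]: "f \<in> carrier A \<Longrightarrow> f g \<in> carrier R"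
  by (cases "g \<in> carrier G") (auto simp: carrier_A_iff)

lemma finite_supp [simp]: "f \<in> carrier A \<Longrightarrow> finite (supp f)"
  by (simp add: carrier_A_iff)

lemma supp_closed: "x \<in> supp f \<Longrightarrow> x \<in> carrier G"
  by (simp add: supp_def)

lemma not_supp_zero: "\<lbrakk>f \<in> carrier A; x \<notin> supp f\<rbrakk> \<Longrightarrow> f x = \<zero>"
  unfolding carrier_A_iff supp_def by blast

lemma A_zero: "\<zero>\<^bsub>A\<^esub> = (\<lambda>_. \<zero>)" unfolding group_ring_def by simp

lemma A_add: "(f \<oplus>\<^bsub>A\<^esub> h) g = f g \<oplus> h g" unfolding group_ring_def by simp

lemma A_one: "\<one>\<^bsub>A\<^esub> g = (if g = \<one>\<^bsub>G\<^esub> then \<one> else \<zero>)" unfolding group_ring_def by simp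

lemma supp_empty_iff: "f \<in> carrier A \<Longrightarrow> supp f = {} \<longleftrightarrow> f = \<zero>\<^bsub>A\<^esub>"
  by (auto simp: A_zero supp_def carrier_A_iff)

lemma A_mult:
  assumes "f \<in> carrier A" "h \<in> carrier A" "g \<in> carrier G" "finite T" "supp f \<subseteq> T"
    "T \<subseteq> carrier G"
  shows "(f \<otimes>\<^bsub>A\<^esub> h) g = (\<Oplus>x\<in>T. f x \<otimes> h (inv\<^bsub>G\<^esub> x \<otimes>\<^bsub>G\<^esub> g))"
proof -
  have "(f \<otimes>\<^bsub>A\<^esub> h) g = (\<Oplus>x\<in>supp f. f x \<otimes> h (inv\<^bsub>G\<^esub> x \<otimes>\<^bsub>G\<^esub> g))"
    using assms(3) unfolding group_ring_def supp_def by simp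
  also have "\<dots> = (\<Oplus>x\<in>T. f x \<otimes> h (inv\<^bsub>G\<^esub> x \<otimes>\<^bsub>G\<^esub> g))"
    using assms by (intro R.finsum_mono_neutral) (auto simp: supp_def)
  finally show ?thesis .
qed

lemma A_finsum:
  "\<lbrakk>finite I; p \<in> I \<rightarrow> carrier A\<rbrakk> \<Longrightarrow> (\<Oplus>\<^bsub>A\<^esub>i\<in>I. p i) g = (\<Oplus>i\<in>I. p i g)"
proof (induction I rule: finite_induct)
  case (insert i I)
  then have "p i \<in> carrier A" "p \<in> I \<rightarrow> carrier A" by auto
  then show ?case using insert by (simp add: A_add Pi_def)
qed (simp add: A_zero)

lemma single_closed [simp]:
  assumes "g \<in> carrier G" "k \<in> carrier R"
  shows "single g k \<in> carrier A"
proof -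
  have "supp (single g k) \<subseteq> {g}" by (auto simp: supp_def single_def)
  then have "finite (supp (single g k))" by (rule finite_subset) simp
  then show ?thesis unfolding carrier_A_iff using assms by (simp add: single_def)
qed

lemma single_mult:
  assumes "g \<in> carrier G" "k \<in> carrier R" "f \<in> carrier A" "h \<in> carrier G"
  shows "(single g k \<otimes>\<^bsub>A\<^esub> f) h = k \<otimes> f (inv\<^bsub>G\<^esub> g \<otimes>\<^bsub>G\<^esub> h)"
proof -
  have "(single g k \<otimes>\<^bsub>A\<^esub> f) h = (\<Oplus>x\<in>{g}. single g k x \<otimes> f (inv\<^bsub>G\<^esub> x \<otimes>\<^bsub>G\<^esub> h))"
    using assms single_closed[of g k] by (intro A_mult) (auto simp: supp_def single_def)
  then show ?thesis using assms by (simp add: single_def)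
qed

lemma finsum_single_term:
  assumes "finite I" "i \<in> I" "\<And>j. j \<in> I \<Longrightarrow> p j \<in> carrier R"
    "\<And>j. \<lbrakk>j \<in> I; j \<noteq> i\<rbrakk> \<Longrightarrow> p j = \<zero>"
  shows "(\<Oplus>j\<in>I. p j) = p i"
proof -
  have "finsum R p {i} = finsum R p I" using assms by (intro R.finsum_mono_neutral) auto
  then show ?thesis using assms by simp
qed

lemma translate_mult:
  assumes "f \<in> carrier A" "r \<in> carrier A" "t \<in> carrier G" "z \<in> carrier G"
  shows "(f \<otimes>\<^bsub>A\<^esub> (single t \<one> \<otimes>\<^bsub>A\<^esub> r)) z =
    (\<Oplus>a\<in>supp f. f a \<otimes> r (inv\<^bsub>G\<^esub> t \<otimes>\<^bsub>G\<^esub> (inv\<^bsub>G\<^esub> a \<otimes>\<^bsub>G\<^esub> z)))"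
proof -
  have "(f \<otimes>\<^bsub>A\<^esub> (single t \<one> \<otimes>\<^bsub>A\<^esub> r)) z =
    (\<Oplus>a\<in>supp f. f a \<otimes> (single t \<one> \<otimes>\<^bsub>A\<^esub> r) (inv\<^bsub>G\<^esub> a \<otimes>\<^bsub>G\<^esub> z))"
    using assms by (intro A_mult) (auto dest: supp_closed)
  also have "\<dots> = (\<Oplus>a\<in>supp f. f a \<otimes> r (inv\<^bsub>G\<^esub> t \<otimes>\<^bsub>G\<^esub> (inv\<^bsub>G\<^esub> a \<otimes>\<^bsub>G\<^esub> z)))"
    using assms by (intro R.finsum_cong') (auto simp: single_mult dest: supp_closed)
  finally show ?thesis .
qed

text \<open>Call \<open>x\<close> bad if \<open>t x\<close> misses \<open>C\<close>. By disjointness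
  the products \<open>a t x\<close> with \<open>x\<close> good are pairwise distinct, and the
  coefficient there is \<open>f a \<otimes> r x\<close>, which is not zero, unless a bad product
  falls on the same point. The factor 2 accounts for the bad products left out (\<open>Q\<close> has
  at most as many elements) and for the good ones that \<open>Q\<close> may destroy.\<close>

lemma card_supp_translate:
  assumes nz: "\<And>a b. \<lbrakk>a \<in> carrier R; b \<in> carrier R; a \<otimes> b = \<zero>\<rbrakk> \<Longrightarrow> a = \<zero> \<or> b = \<zero>"
    and f: "f \<in> carrier A" and r: "r \<in> carrier A" and t: "t \<in> carrier G"
    and disj: "disjoint_family_on (\<lambda>a. a <#\<^bsub>G\<^esub> C) (supp f)"
  shows "card (supp f) * card (supp r) \<le> card (supp (f \<otimes>\<^bsub>A\<^esub> (single t \<one> \<otimes>\<^bsub>A\<^esub> r)))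
    + 2 * card (supp f) * card {x \<in> supp r. t \<otimes>\<^bsub>G\<^esub> x \<notin> C}"
proof -
  let ?F = "supp f" and ?X = "supp r" and ?b = "f \<otimes>\<^bsub>A\<^esub> (single t \<one> \<otimes>\<^bsub>A\<^esub> r)"
  let ?B = "{x \<in> ?X. t \<otimes>\<^bsub>G\<^esub> x \<notin> C}" and ?m = "\<lambda>(a, x). a \<otimes>\<^bsub>G\<^esub> (t \<otimes>\<^bsub>G\<^esub> x)"
  define P where "P = ?m ` (?F \<times> (?X - ?B))"
  define Q where "Q = ?m ` (?F \<times> ?B)"
  have fin: "finite ?F" "finite ?X" "finite ?B" using f r by simp_all
  have good: "a = a' \<and> x = x'"
    if "a \<in> ?F" "a' \<in> ?F" "x \<in> ?X - ?B" "x' \<in> ?X - ?B" "?m (a, x) = ?m (a', x')" for a a' x x'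
  proof -
    have c: "a \<in> carrier G" "a' \<in> carrier G" "x \<in> carrier G" "x' \<in> carrier G"
      using that by (auto dest: supp_closed)
    have mem: "b \<otimes>\<^bsub>G\<^esub> (t \<otimes>\<^bsub>G\<^esub> y) \<in> b <#\<^bsub>G\<^esub> C" if "y \<in> ?X - ?B" for b y
      using that unfolding l_coset_def by blast
    have "(a <#\<^bsub>G\<^esub> C) \<inter> (a' <#\<^bsub>G\<^esub> C) \<noteq> {}"
      using mem[OF that(3), of a] mem[OF that(4), of a'] that(5) by auto
    then have "a = a'" using disjoint_family_onD[OF disj that(1,2)] by blast
    then show ?thesis using that(5) c t by simp
  qed
  have "inj_on ?m (?F \<times> (?X - ?B))"
  proof (rule inj_onI)
    fix p q assume "p \<in> ?F \<times> (?X - ?B)" "q \<in> ?F \<times> (?X - ?B)" "?m p = ?m q"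
    then show "p = q" using good[of "fst p" "fst q" "snd p" "snd q"]
      by (simp add: mem_Times_iff prod_eq_iff case_prod_beta)
  qed
  then have cP: "card P = card ?F * card (?X - ?B)"
    by (simp add: P_def card_image card_cartesian_product)
  have cQ: "card Q \<le> card ?F * card ?B"
    using card_image_le[of "?F \<times> ?B" ?m] fin by (simp add: Q_def card_cartesian_product)
  have cX: "card ?X = card (?X - ?B) + card ?B"
    using fin card_Un_disjoint[of "?X - ?B" ?B] by (simp add: Un_absorb2 Int_commute)
  have "P - Q \<subseteq> supp ?b"
  proof
    fix z assume z: "z \<in> P - Q"
    then obtain a x where ax: "a \<in> ?F" "x \<in> ?X - ?B" "z = a \<otimes>\<^bsub>G\<^esub> (t \<otimes>\<^bsub>G\<^esub> x)"
      by (auto simp: P_def)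
    then have c: "a \<in> carrier G" "x \<in> carrier G" by (auto dest: supp_closed)
    then have zc: "z \<in> carrier G" using ax t by simp
    have "?b z = (\<Oplus>a\<in>?F. f a \<otimes> r (inv\<^bsub>G\<^esub> t \<otimes>\<^bsub>G\<^esub> (inv\<^bsub>G\<^esub> a \<otimes>\<^bsub>G\<^esub> z)))"
      using f r t zc by (rule translate_mult)
    also have "\<dots> = f a \<otimes> r (inv\<^bsub>G\<^esub> t \<otimes>\<^bsub>G\<^esub> (inv\<^bsub>G\<^esub> a \<otimes>\<^bsub>G\<^esub> z))"
    proof (rule finsum_single_term[OF fin(1) ax(1)])
      fix a' assume a': "a' \<in> ?F" "a' \<noteq> a"
      then have a'c: "a' \<in> carrier G" by (auto dest: supp_closed)
      let ?x = "inv\<^bsub>G\<^esub> t \<otimes>\<^bsub>G\<^esub> (inv\<^bsub>G\<^esub> a' \<otimes>\<^bsub>G\<^esub> z)"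
      have zx: "z = a' \<otimes>\<^bsub>G\<^esub> (t \<otimes>\<^bsub>G\<^esub> ?x)"
        using a'c t zc by (simp add: G.m_assoc[symmetric])
      have "?x \<notin> ?X"
      proof
        assume "?x \<in> ?X"
        moreover have "?x \<notin> ?B"
        proof
          assume "?x \<in> ?B"
          then have "?m (a', ?x) \<in> Q" unfolding Q_def using a' by (intro imageI SigmaI)
          then show False using z zx by simp
        qed
        ultimately have "?x \<in> ?X - ?B" by blast
        then show False using good[OF ax(1) a'(1) ax(2)] zx ax(3) a'(2) by auto
      qed
      then show "f a' \<otimes> r ?x = \<zero>" using f not_supp_zero[OF r] by simp
    qed (use f r in simp)
    also have "inv\<^bsub>G\<^esub> t \<otimes>\<^bsub>G\<^esub> (inv\<^bsub>G\<^esub> a \<otimes>\<^bsub>G\<^esub> z) = x"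
      using ax(3) c t by (simp add: G.m_assoc[symmetric])
    finally have "?b z = f a \<otimes> r x" .
    moreover have "f a \<otimes> r x \<noteq> \<zero>" using nz[of "f a" "r x"] f r ax by (auto simp: supp_def)
    ultimately show "z \<in> supp ?b" using zc by (simp add: supp_def)
  qed
  then have "card (P - Q) \<le> card (supp ?b)"
    using f r t by (intro card_mono) auto
  moreover have "card P - card Q \<le> card (P - Q)"
    by (rule diff_card_le_card_Diff) (simp add: Q_def fin)
  ultimately have "card P \<le> card (supp ?b) + card ?F * card ?B" using cQ by linarith
  then show ?thesis by (simp add: cX cP algebra_simps)
qed

text \<open>For a particular \<open>i\<close> all of \<open>supp r\<close> may be bad, since
  \<open>t\<close> is fixed before \<open>r\<close>. But each \<open>x\<close> is bad for few
  \<open>i\<close>, so exchanging the summation bounds the total number of bad pairs for every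
  \<open>r\<close> at once.\<close>

lemma PHP_growth:
  assumes nz: "\<And>a b. \<lbrakk>a \<in> carrier R; b \<in> carrier R; a \<otimes> b = \<zero>\<rbrakk> \<Longrightarrow> a = \<zero> \<or> b = \<zero>"
    and "PHP G" and f: "f \<in> carrier A" "f \<noteq> \<zero>\<^bsub>A\<^esub>"
  obtains n t where "t \<in> {1..n::nat} \<rightarrow> carrier G"
    "\<And>r. r \<in> carrier A \<Longrightarrow>
      m * card (supp r) \<le> (\<Sum>i=1..n. card (supp (f \<otimes>\<^bsub>A\<^esub> (single (t i) \<one> \<otimes>\<^bsub>A\<^esub> r))))"
proof -
  let ?F = "supp f"
  have F: "?F \<subseteq> carrier G" "finite ?F" using f by (auto dest: supp_closed)
  have F1: "card ?F \<ge> 1" using F f supp_empty_iff by (simp add: Suc_le_eq card_gt_0_iff)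
  \<comment> \<open>With 1/4 the loss \<open>2 |F| |X| n / 4\<close> is half of
    \<open>n |F| |X|\<close>; asking for \<open>2 * m\<close> translates makes up for that
    half.\<close>
  have "(1 / 4 :: real) > 0" by simp
  from G.PHP_sparse[OF \<open>PHP G\<close> F this, of "2 * m"]
  obtain n :: nat and t C where n: "2 * m \<le> n"
    and tC: "\<forall>i\<in>{1..n}. t i \<in> carrier G \<and> disjoint_family_on (\<lambda>a. a <#\<^bsub>G\<^esub> C i) ?F"
    and sparse: "\<forall>x\<in>carrier G.
      real (card {i \<in> {1..n}. t i \<otimes>\<^bsub>G\<^esub> x \<notin> C i}) \<le> 1 / 4 * real n"
    by blast
  show ?thesis
  proof (rule that[of t n])
    show "t \<in> {1..n} \<rightarrow> carrier G" using tC by auto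
    fix r assume r: "r \<in> carrier A"
    let ?X = "supp r" and ?W = "\<Sum>i=1..n. card (supp (f \<otimes>\<^bsub>A\<^esub> (single (t i) \<one> \<otimes>\<^bsub>A\<^esub> r)))"
    let ?bad = "\<lambda>i. {x \<in> ?X. t i \<otimes>\<^bsub>G\<^esub> x \<notin> C i}"
    have finX: "finite ?X" using r by simp
    have "n * (card ?F * card ?X) = (\<Sum>i=1..n. card ?F * card ?X)" by simp
    also have "\<dots> \<le> (\<Sum>i=1..n. card (supp (f \<otimes>\<^bsub>A\<^esub> (single (t i) \<one> \<otimes>\<^bsub>A\<^esub> r)))
        + 2 * card ?F * card (?bad i))"
      using nz f(1) r tC by (intro sum_mono card_supp_translate) auto
    also have "\<dots> = ?W + 2 * card ?F * (\<Sum>i=1..n. card (?bad i))"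
      by (simp add: sum.distrib sum_distrib_left)
    finally have 1: "n * (card ?F * card ?X) \<le> ?W + 2 * card ?F * (\<Sum>i=1..n. card (?bad i))" .
    have "(\<Sum>i=1..n. card (?bad i)) = (\<Sum>x\<in>?X. card {i \<in> {1..n}. t i \<otimes>\<^bsub>G\<^esub> x \<notin> C i})"
      using sum_multicount_gen[of "{1..n}" ?X "\<lambda>i x. t i \<otimes>\<^bsub>G\<^esub> x \<notin> C i"
        "\<lambda>x. card {i \<in> {1..n}. t i \<otimes>\<^bsub>G\<^esub> x \<notin> C i}"] finX by simp
    then have "real (\<Sum>i=1..n. card (?bad i))
        = (\<Sum>x\<in>?X. real (card {i \<in> {1..n}. t i \<otimes>\<^bsub>G\<^esub> x \<notin> C i}))" by simp
    also have "\<dots> \<le> (\<Sum>x\<in>?X. 1 / 4 * real n)"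
    proof (rule sum_mono)
      fix x assume "x \<in> ?X"
      then have x: "x \<in> carrier G" by (rule supp_closed)
      show "real (card {i \<in> {1..n}. t i \<otimes>\<^bsub>G\<^esub> x \<notin> C i}) \<le> 1 / 4 * real n"
        using sparse x by blast
    qed
    also have "\<dots> = card ?X * n / 4" by simp
    finally have "4 * (\<Sum>i=1..n. card (?bad i)) \<le> card ?X * n" by linarith
    with 1 have "n * (card ?F * card ?X) \<le> 2 * ?W" by (rule half_bound)
    moreover have "(2 * m) * (1 * card ?X) \<le> n * (card ?F * card ?X)"
      using n F1 by (intro mult_le_mono) auto
    ultimately show "m * card ?X \<le> ?W" by linarith
  qed
qed

end

section \<open>Proper right ideals of group rings\<close>

context group_algebra
begin

lemma coeff_perturbed_one:
  assumes P: "finite P" and v: "v \<in> P \<rightarrow> carrier G" and t: "t \<in> P \<rightarrow> carrier G"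
    and b: "b \<in> carrier A" and r: "r \<in> carrier A" and h: "h \<in> carrier G"
  defines "e \<equiv> \<Oplus>\<^bsub>A\<^esub>p\<in>P. single (v p) \<one> \<otimes>\<^bsub>A\<^esub> (b \<otimes>\<^bsub>A\<^esub> single (t p) \<one>)"
  shows "((\<one>\<^bsub>A\<^esub> \<oplus>\<^bsub>A\<^esub> e) \<otimes>\<^bsub>A\<^esub> r) h =
    r h \<oplus> (\<Oplus>p\<in>P. (b \<otimes>\<^bsub>A\<^esub> (single (t p) \<one> \<otimes>\<^bsub>A\<^esub> r)) (inv\<^bsub>G\<^esub> (v p) \<otimes>\<^bsub>G\<^esub> h))"
proof -
  have c: "v p \<in> carrier G" "t p \<in> carrier G" if "p \<in> P" for p using v t that by auto
  have "e \<otimes>\<^bsub>A\<^esub> r = (\<Oplus>\<^bsub>A\<^esub>p\<in>P. single (v p) \<one> \<otimes>\<^bsub>A\<^esub> (b \<otimes>\<^bsub>A\<^esub> single (t p) \<one>) \<otimes>\<^bsub>A\<^esub> r)"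
    unfolding e_def using P b r c by (intro A.finsum_ldistr) auto
  also have "\<dots> = (\<Oplus>\<^bsub>A\<^esub>p\<in>P. single (v p) \<one> \<otimes>\<^bsub>A\<^esub> (b \<otimes>\<^bsub>A\<^esub> (single (t p) \<one> \<otimes>\<^bsub>A\<^esub> r)))"
    using b r c by (intro A.finsum_cong') (auto simp: A.m_assoc)
  finally have "(e \<otimes>\<^bsub>A\<^esub> r) h =
      (\<Oplus>p\<in>P. (single (v p) \<one> \<otimes>\<^bsub>A\<^esub> (b \<otimes>\<^bsub>A\<^esub> (single (t p) \<one> \<otimes>\<^bsub>A\<^esub> r))) h)"
    using P b r c by (simp add: A_finsum)
  also have "\<dots> = (\<Oplus>p\<in>P. (b \<otimes>\<^bsub>A\<^esub> (single (t p) \<one> \<otimes>\<^bsub>A\<^esub> r)) (inv\<^bsub>G\<^esub> (v p) \<otimes>\<^bsub>G\<^esub> h))"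
    using b r c h by (intro R.finsum_cong') (auto simp: single_mult)
  finally have "(e \<otimes>\<^bsub>A\<^esub> r) h = \<dots>" .
  moreover have "e \<in> carrier A" unfolding e_def using b c by (intro A.finsum_closed) auto
  ultimately show ?thesis using r by (simp add: A.l_distr A_add)
qed

text \<open>
  Each product \<open>b t r\<close> enters \<open>e b r\<close> with three free factors on the left.  If the supports of
  the products have total size \<open>W\<close>, this gives a forest with \<open>3 W\<close> edges and at most \<open>W\<close> tails.
  If the combination were \<open>1\<close>, every head would be hit twice or lie in \<open>S\<close>, so that there would be
  at most \<open>3 W / 2 + |S|\<close> heads, where \<open>|S| \<le> 1 + W / 5\<close>; these are too few vertices.
\<close>

theorem right_primitive_group_ring:
  fixes u :: "('g \<Rightarrow> 'r) \<times> nat \<times> nat \<Rightarrow> 'g"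
  assumes nz: "\<And>a b. \<lbrakk>a \<in> carrier R; b \<in> carrier R; a \<otimes> b = \<zero>\<rbrakk> \<Longrightarrow> a = \<zero> \<or> b = \<zero>"
    and one: "\<one> \<noteq> \<zero>"
    and PHP: "PHP G" and u: "free_family G (T \<times> UNIV \<times> UNIV) u"
    and T: "T \<subseteq> carrier A - {\<zero>\<^bsub>A\<^esub>}"
    and dense: "\<And>a. \<lbrakk>a \<in> carrier A; a \<noteq> \<zero>\<^bsub>A\<^esub>\<rbrakk> \<Longrightarrow> \<exists>b\<in>T. b \<in> genideal A {a}"
  shows "right_primitive A"
proof -
  \<comment> \<open>The factor 5 comes from the final count. If \<open>X\<close> is the total size
    of the supports of the \<open>r j\<close>, then \<open>2 W + 2 (1 + X) < 3 W\<close> is needed,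
    and this follows from \<open>5 X \<le> W\<close> once \<open>X \<ge> 1\<close>. The latter holds
    because otherwise the combination would be zero.\<close>
  have "\<exists>n t. t \<in> {1..n::nat} \<rightarrow> carrier G \<and> (\<forall>r\<in>carrier A.
      5 * card (supp r) \<le> (\<Sum>i=1..n. card (supp (b \<otimes>\<^bsub>A\<^esub> (single (t i) \<one> \<otimes>\<^bsub>A\<^esub> r)))))"
    if "b \<in> T" for b
  proof -
    have b: "b \<in> carrier A" "b \<noteq> \<zero>\<^bsub>A\<^esub>" using T that by auto
    show ?thesis by (rule PHP_growth[OF nz PHP b, of 5]) blast+
  qed
  then obtain n :: "('g \<Rightarrow> 'r) \<Rightarrow> nat" and t where
    nt: "\<forall>b\<in>T. t b \<in> {1..n b} \<rightarrow> carrier G \<and> (\<forall>r\<in>carrier A. 5 * card (supp r) \<le>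
      (\<Sum>i=1..n b. card (supp (b \<otimes>\<^bsub>A\<^esub> (single (t b i) \<one> \<otimes>\<^bsub>A\<^esub> r)))))"
    by metis
  \<comment> \<open>The second component only makes copies: each \<open>t b i\<close> occurs with
    three different free factors. The copies have the same tails, so the edges are three times
    \<open>W\<close> while the tails number at most \<open>W\<close>.\<close>
  define P where "P b = {1..n b} \<times> {..<3::nat}" for b
  have finP: "finite (P b)" for b by (simp add: P_def)
  have uc: "u (b, p) \<in> carrier G" if "b \<in> T" for b p
    using u that by (cases p) (auto simp: free_family_def)
  have tc: "t b (fst p) \<in> carrier G" if "b \<in> T" "p \<in> P b" for b p
  proof -
    have "t b \<in> {1..n b} \<rightarrow> carrier G" using nt that(1) by blast
    then show ?thesis using that(2) by (auto simp: P_def)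
  qed
  define e where
    "e b = (\<Oplus>\<^bsub>A\<^esub>p\<in>P b. single (u (b, p)) \<one> \<otimes>\<^bsub>A\<^esub> (b \<otimes>\<^bsub>A\<^esub> single (t b (fst p)) \<one>))" for b
  have Tc: "b \<in> carrier A" if "b \<in> T" for b using T that by blast
  have e_Idl: "e b \<in> genideal A {b}" if "b \<in> T" for b
  proof -
    interpret ideal "genideal A {b}" A using Tc[OF that] by (intro A.genideal_ideal) simp
    have "single (u (b, p)) \<one> \<otimes>\<^bsub>A\<^esub> (b \<otimes>\<^bsub>A\<^esub> single (t b (fst p)) \<one>) \<in> genideal A {b}"
      if "p \<in> P b" for p
      using that \<open>b \<in> T\<close> A.genideal_self'[OF Tc] uc tc by (intro I_l_closed I_r_closed) auto
    then show ?thesis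
      unfolding e_def using finP ideal_axioms by (intro A.ideal_finsum_closed) auto
  qed
  have ec: "e b \<in> carrier A" if "b \<in> T" for b
    unfolding e_def using that Tc uc tc by (intro A.finsum_closed) auto
  define I where "I = {\<Oplus>\<^bsub>A\<^esub>j\<in>J. (\<one>\<^bsub>A\<^esub> \<oplus>\<^bsub>A\<^esub> e j) \<otimes>\<^bsub>A\<^esub> r j | J r.
    finite J \<and> J \<subseteq> T \<and> r \<in> J \<rightarrow> carrier A}"
  have "(\<lambda>j. \<one>\<^bsub>A\<^esub> \<oplus>\<^bsub>A\<^esub> e j) \<in> T \<rightarrow> carrier A" using ec by simp
  note I = A.right_ideal_generated[OF this, folded I_def]
  have "\<one>\<^bsub>A\<^esub> \<notin> I"
  proof
    assume "\<one>\<^bsub>A\<^esub> \<in> I"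
    then obtain J r where J: "finite J" "J \<subseteq> T" "r \<in> J \<rightarrow> carrier A"
      and sum1: "\<one>\<^bsub>A\<^esub> = (\<Oplus>\<^bsub>A\<^esub>j\<in>J. (\<one>\<^bsub>A\<^esub> \<oplus>\<^bsub>A\<^esub> e j) \<otimes>\<^bsub>A\<^esub> r j)"
      unfolding I_def by blast
    have JT: "j \<in> T" "j \<in> carrier A" "r j \<in> carrier A" if "j \<in> J" for j
      using J Tc that by auto
    define \<beta> where "\<beta> j i = j \<otimes>\<^bsub>A\<^esub> (single (t j i) \<one> \<otimes>\<^bsub>A\<^esub> r j)" for j i
    have \<beta>c: "\<beta> j (fst p) \<in> carrier A" if "j \<in> J" "p \<in> P j" for j p
      unfolding \<beta>_def using that JT tc by simp
    define K where "K = Sigma J P"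
    define Z where "Z k = supp (\<beta> (fst k) (fst (snd k)))" for k :: "('g \<Rightarrow> 'r) \<times> nat \<times> nat"
    have finK: "finite K" using J finP by (simp add: K_def)
    have KI: "K \<subseteq> T \<times> UNIV \<times> UNIV" using J by (auto simp: K_def)
    have finZ: "finite (Z k)" if "k \<in> K" for k
      using that \<beta>c by (auto simp: K_def Z_def)
    have Zc: "Z k \<subseteq> carrier G" for k by (auto simp: Z_def dest: supp_closed)
    have coeff: "\<one>\<^bsub>A\<^esub> h = (\<Oplus>j\<in>J. r j h \<oplus> (\<Oplus>p\<in>P j. \<beta> j (fst p) (inv\<^bsub>G\<^esub> (u (j, p)) \<otimes>\<^bsub>G\<^esub> h)))"
      if h: "h \<in> carrier G" for h
    proof -
      have "\<one>\<^bsub>A\<^esub> h = (\<Oplus>\<^bsub>A\<^esub>j\<in>J. (\<one>\<^bsub>A\<^esub> \<oplus>\<^bsub>A\<^esub> e j) \<otimes>\<^bsub>A\<^esub> r j) h"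
        by (rule arg_cong[OF sum1])
      also have "\<dots> = (\<Oplus>j\<in>J. ((\<one>\<^bsub>A\<^esub> \<oplus>\<^bsub>A\<^esub> e j) \<otimes>\<^bsub>A\<^esub> r j) h)"
        using J(1) JT ec by (intro A_finsum) auto
      also have "\<dots> = (\<Oplus>j\<in>J. r j h \<oplus> (\<Oplus>p\<in>P j. \<beta> j (fst p) (inv\<^bsub>G\<^esub> (u (j, p)) \<otimes>\<^bsub>G\<^esub> h)))"
        unfolding e_def \<beta>_def
        using JT tc uc h finP
        by (intro R.finsum_cong' refl coeff_perturbed_one) (auto intro!: R.finsum_closed)
      finally show ?thesis .
    qed
    define W where "W = (\<Sum>j\<in>J. \<Sum>i=1..n j. card (supp (\<beta> j i)))"
    have sumZ: "(\<Sum>k\<in>K. card (Z k)) = 3 * W"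
    proof -
      have "(\<Sum>k\<in>K. card (Z k)) = (\<Sum>j\<in>J. \<Sum>p\<in>P j. card (supp (\<beta> j (fst p))))"
        using J finP unfolding K_def Z_def by (subst sum.Sigma) (auto simp: case_prod_beta)
      also have "\<dots> = (\<Sum>j\<in>J. \<Sum>i=1..n j. \<Sum>l<3::nat. card (supp (\<beta> j i)))"
        by (simp only: P_def sum.cartesian_product case_prod_unfold)
      also have "\<dots> = 3 * W" by (simp add: W_def sum_distrib_left)
      finally show ?thesis .
    qed
    have tails: "card (\<Union>k\<in>K. Z k) \<le> W"
    proof -
      have "(\<Union>k\<in>K. Z k) \<subseteq> (\<Union>(j, i)\<in>Sigma J (\<lambda>j. {1..n j}). supp (\<beta> j i))"
        by (fastforce simp: K_def P_def Z_def)
      moreover have fin: "finite (supp (\<beta> j i))" if "j \<in> J" "i \<in> {1..n j}" for j i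
        using \<beta>c[of j "(i, 0)"] that by (simp add: P_def)
      ultimately have "card (\<Union>k\<in>K. Z k) \<le> card (\<Union>(j, i)\<in>Sigma J (\<lambda>j. {1..n j}). supp (\<beta> j i))"
        using J by (intro card_mono) auto
      also have "\<dots> \<le> (\<Sum>(j, i)\<in>Sigma J (\<lambda>j. {1..n j}). card (supp (\<beta> j i)))"
        using card_UN_le[of "Sigma J (\<lambda>j. {1..n j})" "\<lambda>(j, i). supp (\<beta> j i)"] J
        by (simp add: case_prod_beta)
      also have "\<dots> = W" using J by (simp add: W_def sum.Sigma)
      finally show ?thesis .
    qed
    \<comment> \<open>The points where the equation has contributions other than edges: the support
      of its left-hand side and those of the summands \<open>r j\<close>.\<close>
    let ?S = "insert \<one>\<^bsub>G\<^esub> (\<Union>j\<in>J. supp (r j))"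
    have finS: "finite ?S" using J JT by auto
    have growth: "5 * card (supp (r j)) \<le> (\<Sum>i=1..n j. card (supp (\<beta> j i)))" if "j \<in> J" for j
      using nt JT[OF that] unfolding \<beta>_def by blast
    have sumX: "5 * (\<Sum>j\<in>J. card (supp (r j))) \<le> W"
      unfolding W_def sum_distrib_left using growth by (rule sum_mono)
    have "card ?S \<le> 1 + card (\<Union>j\<in>J. supp (r j))"
      using card_Un_le[of "{\<one>\<^bsub>G\<^esub>}" "\<Union>j\<in>J. supp (r j)"] by simp
    also have "card (\<Union>j\<in>J. supp (r j)) \<le> (\<Sum>j\<in>J. card (supp (r j)))"
      using J(1) by (rule card_UN_le)
    finally have cS: "card ?S \<le> 1 + (\<Sum>j\<in>J. card (supp (r j)))" by simp
    have "(\<Sum>j\<in>J. card (supp (r j))) \<noteq> 0"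
    proof
      assume "(\<Sum>j\<in>J. card (supp (r j))) = 0"
      then have card0: "\<forall>j\<in>J. card (supp (r j)) = 0" using J(1) by (simp only: sum_eq_0_iff)
      have "r j = \<zero>\<^bsub>A\<^esub>" if "j \<in> J" for j
      proof -
        have "supp (r j) = {}"
          using card0 that finite_supp[OF JT(3)[OF that]] card_0_eq by blast
        then show ?thesis using supp_empty_iff[OF JT(3)[OF that]] by blast
      qed
      then have "(\<Oplus>\<^bsub>A\<^esub>j\<in>J. (\<one>\<^bsub>A\<^esub> \<oplus>\<^bsub>A\<^esub> e j) \<otimes>\<^bsub>A\<^esub> r j) = (\<Oplus>\<^bsub>A\<^esub>j\<in>J. \<zero>\<^bsub>A\<^esub>)"
        using JT ec by (intro A.finsum_cong') auto
      then have "\<one>\<^bsub>A\<^esub> = \<zero>\<^bsub>A\<^esub>" using sum1 by simp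
      then have "\<one>\<^bsub>A\<^esub> \<one>\<^bsub>G\<^esub> = \<zero>\<^bsub>A\<^esub> \<one>\<^bsub>G\<^esub>" by simp
      then show False using one by (simp add: A_one A_zero)
    qed
    then have many: "2 * card (\<Union>k\<in>K. Z k) + 2 * card ?S < (\<Sum>k\<in>K. card (Z k))"
      using tails cS sumX sumZ by linarith
    obtain k z where k: "k \<in> K" "z \<in> Z k" "u k \<otimes>\<^bsub>G\<^esub> z \<notin> ?S"
      and lonely: "\<And>k'. \<lbrakk>k' \<in> K; k' \<noteq> k\<rbrakk> \<Longrightarrow> inv\<^bsub>G\<^esub> (u k') \<otimes>\<^bsub>G\<^esub> (u k \<otimes>\<^bsub>G\<^esub> z) \<notin> Z k'"
      using G.free_family_lonely_edge[OF u finK KI finZ Zc finS many] by metis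
    obtain j p where jp: "k = (j, p)" "j \<in> J" "p \<in> P j" using k(1) by (auto simp: K_def)
    \<comment> \<open>At this head everything vanishes except the contribution of the one edge
      ending there. That contribution is not zero, whereas the left-hand side of the equation is
      zero at \<open>h\<close>.\<close>
    define h where "h = u k \<otimes>\<^bsub>G\<^esub> z"
    have zc: "z \<in> carrier G" using k(2) Zc by blast
    have ukc: "u k \<in> carrier G" using jp uc JT by simp
    have hc: "h \<in> carrier G" using zc ukc by (simp add: h_def)
    have rh: "r j' h = \<zero>" if "j' \<in> J" for j'
      using k(3) not_supp_zero[OF JT(3)[OF that]] that by (auto simp: h_def)
    have term0: "\<beta> j' (fst p') (inv\<^bsub>G\<^esub> (u (j', p')) \<otimes>\<^bsub>G\<^esub> h) = \<zero>"
      if "j' \<in> J" "p' \<in> P j'" "(j', p') \<noteq> (j, p)" for j' p'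
      using lonely[of "(j', p')"] that jp not_supp_zero[OF \<beta>c[OF that(1,2)]]
      by (simp add: K_def Z_def h_def)
    have tc': "\<beta> j' (fst p') g \<in> carrier R" if "j' \<in> J" "p' \<in> P j'" for j' p' g
      using \<beta>c[OF that] by simp
    have "\<one>\<^bsub>A\<^esub> h = r j h \<oplus> (\<Oplus>p\<in>P j. \<beta> j (fst p) (inv\<^bsub>G\<^esub> (u (j, p)) \<otimes>\<^bsub>G\<^esub> h))"
      unfolding coeff[OF hc]
    proof (rule finsum_single_term[OF J(1) jp(2)])
      fix j' assume j': "j' \<in> J"
      show "r j' h \<oplus> (\<Oplus>p\<in>P j'. \<beta> j' (fst p) (inv\<^bsub>G\<^esub> (u (j', p)) \<otimes>\<^bsub>G\<^esub> h)) \<in> carrier R"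
        using tc' j' JT by (intro R.a_closed R.finsum_closed) auto
      assume "j' \<noteq> j"
      then have "(\<Oplus>p\<in>P j'. \<beta> j' (fst p) (inv\<^bsub>G\<^esub> (u (j', p)) \<otimes>\<^bsub>G\<^esub> h)) = (\<Oplus>p\<in>P j'. \<zero>)"
        using term0 j' by (intro R.finsum_cong') auto
      then show "r j' h \<oplus> (\<Oplus>p\<in>P j'. \<beta> j' (fst p) (inv\<^bsub>G\<^esub> (u (j', p)) \<otimes>\<^bsub>G\<^esub> h)) = \<zero>"
        using rh j' by simp
    qed
    also have "(\<Oplus>p\<in>P j. \<beta> j (fst p) (inv\<^bsub>G\<^esub> (u (j, p)) \<otimes>\<^bsub>G\<^esub> h)) =
        \<beta> j (fst p) (inv\<^bsub>G\<^esub> (u (j, p)) \<otimes>\<^bsub>G\<^esub> h)"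
      by (rule finsum_single_term[OF finP jp(3)]) (use tc' term0 jp in auto)
    also have "inv\<^bsub>G\<^esub> (u (j, p)) \<otimes>\<^bsub>G\<^esub> h = z"
      using ukc zc jp by (simp add: h_def G.m_assoc[symmetric])
    finally have "\<one>\<^bsub>A\<^esub> h = \<beta> j (fst p) z" using rh jp tc' by simp
    moreover have "\<one>\<^bsub>A\<^esub> h = \<zero>" using k(3) by (simp add: A_one h_def)
    moreover have "\<beta> j (fst p) z \<noteq> \<zero>" using k(2) jp by (simp add: Z_def supp_def)
    ultimately show False by simp
  qed
  moreover have "\<exists>e'\<in>genideal A {a}. \<one>\<^bsub>A\<^esub> \<oplus>\<^bsub>A\<^esub> e' \<in> I"
    if a: "a \<in> carrier A" "a \<noteq> \<zero>\<^bsub>A\<^esub>" for a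
  proof -
    obtain b where b: "b \<in> T" "b \<in> genideal A {a}" using dense[OF a] by blast
    have "genideal A {b} \<subseteq> genideal A {a}"
      using a b by (intro A.genideal_minimal A.genideal_ideal) auto
    then show ?thesis using e_Idl[OF b(1)] I(2)[OF b(1)] by blast
  qed
  ultimately show ?thesis by (rule A.right_primitive_criterion[OF I(1)])
qed

end

section \<open>Ideals and coefficients\<close>

text \<open>If each \<open>b\<close> in \<open>F\<close> is exceptional for fewer than
  \<open>n / |F|\<close> indices, some \<open>t i\<close> carries all of \<open>F\<close> into
  \<open>C i\<close>. Disjointness of the sets \<open>a <# C i\<close> then recovers
  \<open>a\<close>, and cancellation recovers \<open>b\<close>.\<close>

lemma (in group) PHP_generic_element:
  assumes PHP: "PHP G" and F: "F \<subseteq> carrier G" "finite F"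
  obtains x where "x \<in> carrier G"
    "\<And>a b a' b'. \<lbrakk>a \<in> F; b \<in> F; a' \<in> F; b' \<in> F; a \<otimes> (x \<otimes> b) = a' \<otimes> (x \<otimes> b')\<rbrakk> \<Longrightarrow>
      a = a' \<and> b = b'"
proof -
  \<comment> \<open>The added 1 makes the inequality \<open>|F| \<epsilon> n < n\<close> strict and
    covers empty \<open>F\<close>.\<close>
  define \<epsilon> :: real where "\<epsilon> = 1 / (real (card F) + 1)"
  have "\<epsilon> > 0" by (simp add: \<epsilon>_def add_nonneg_pos)
  from PHP_sparse[OF PHP F this, of 1]
  obtain n :: nat and t C where n: "1 \<le> n"
    and tC: "\<forall>i\<in>{1..n}. t i \<in> carrier G \<and> disjoint_family_on (\<lambda>a. a <# C i) F"
    and sparse: "\<forall>x\<in>carrier G. real (card {i \<in> {1..n}. t i \<otimes> x \<notin> C i}) \<le> \<epsilon> * real n"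
    by blast
  have "\<exists>i\<in>{1..n}. \<forall>b\<in>F. t i \<otimes> b \<in> C i"
  proof (rule ccontr)
    assume "\<not> ?thesis"
    then have "{1..n} \<subseteq> (\<Union>b\<in>F. {i \<in> {1..n}. t i \<otimes> b \<notin> C i})" by blast
    then have "card {1..n} \<le> card (\<Union>b\<in>F. {i \<in> {1..n}. t i \<otimes> b \<notin> C i})"
      using F by (intro card_mono) auto
    also have "\<dots> \<le> (\<Sum>b\<in>F. card {i \<in> {1..n}. t i \<otimes> b \<notin> C i})" using F by (intro card_UN_le)
    finally have "n \<le> (\<Sum>b\<in>F. card {i \<in> {1..n}. t i \<otimes> b \<notin> C i})" by simp
    then have "real n \<le> real (\<Sum>b\<in>F. card {i \<in> {1..n}. t i \<otimes> b \<notin> C i})"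
      by (rule of_nat_mono)
    also have "\<dots> = (\<Sum>b\<in>F. real (card {i \<in> {1..n}. t i \<otimes> b \<notin> C i}))" by simp
    also have "\<dots> \<le> (\<Sum>b\<in>F. \<epsilon> * real n)" using sparse F by (intro sum_mono) blast
    also have "\<dots> = real (card F) / (real (card F) + 1) * real n" by (simp add: \<epsilon>_def)
    also have "\<dots> < 1 * real n" using n by (intro mult_strict_right_mono) auto
    finally show False by simp
  qed
  then obtain i where i: "i \<in> {1..n}" "\<forall>b\<in>F. t i \<otimes> b \<in> C i" by blast
  have ti: "t i \<in> carrier G" and disj: "disjoint_family_on (\<lambda>a. a <# C i) F"
    using tC i(1) by blast+
  show ?thesis
  proof (rule that[OF ti])
    fix a b a' b' assume *: "a \<in> F" "b \<in> F" "a' \<in> F" "b' \<in> F"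
      and eq: "a \<otimes> (t i \<otimes> b) = a' \<otimes> (t i \<otimes> b')"
    have "a \<otimes> (t i \<otimes> b) \<in> a <# C i" "a' \<otimes> (t i \<otimes> b') \<in> a' <# C i"
      using i(2) *(2,4) unfolding l_coset_def by blast+
    then have "(a <# C i) \<inter> (a' <# C i) \<noteq> {}" using eq by auto
    then have "a = a'" using disjoint_family_onD[OF disj *(1,3)] by blast
    moreover have "a \<in> carrier G" "b \<in> carrier G" "b' \<in> carrier G" using * F by blast+
    ultimately show "a = a' \<and> b = b'" using eq ti by simp
  qed
qed

section \<open>Elements with restricted coefficients\<close>

context group_algebra
begin

definition with_coeffs :: "'r set \<Rightarrow> ('g \<Rightarrow> 'r) set" where
  "with_coeffs Q = {f \<in> carrier A. \<forall>g\<in>carrier G. f g \<in> Q}"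

lemma with_coeffs_carrier: "with_coeffs (carrier R) = carrier A"
  by (auto simp: with_coeffs_def)

text \<open>An element is determined by its graph over the support; a chosen enumeration of this
  finite graph encodes it as a list of pairs.\<close>

lemma with_coeffs_lepoll:
  assumes D: "infinite D" "carrier G \<lesssim> D" "Q \<lesssim> D"
  shows "with_coeffs Q \<lesssim> D"
proof -
  let ?graph = "\<lambda>f. (\<lambda>g. (g, f g)) ` supp f"
  have "\<exists>xs. set xs = ?graph f" if "f \<in> with_coeffs Q" for f
    using that by (intro finite_list) (simp add: with_coeffs_def)
  then obtain l where l: "\<And>f. f \<in> with_coeffs Q \<Longrightarrow> set (l f) = ?graph f" by metis
  have "inj_on l (with_coeffs Q)"
  proof (rule inj_onI, rule ext)
    fix f h g assume f: "f \<in> with_coeffs Q" and h: "h \<in> with_coeffs Q" and "l f = l h"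
    then have eq: "?graph f = ?graph h" using l by metis
    have fh: "f \<in> carrier A" "h \<in> carrier A" using f h by (simp_all add: with_coeffs_def)
    have "fst ` ?graph f = fst ` ?graph h" using eq by simp
    then have supp: "supp f = supp h" by (simp add: image_image)
    show "f g = h g"
    proof (cases "g \<in> supp f")
      case True
      then have "(g, f g) \<in> ?graph h" using eq by blast
      then show ?thesis by auto
    next
      case False
      then show ?thesis using not_supp_zero fh supp by metis
    qed
  qed
  moreover have "l ` with_coeffs Q \<subseteq> lists (carrier G \<times> Q)"
    using l by (auto simp: supp_def with_coeffs_def)
  ultimately have "with_coeffs Q \<lesssim> lists (carrier G \<times> Q)" unfolding lepoll_def by blast
  also have "\<dots> \<lesssim> lists D" using infinite_times_lepoll[OF D] by (rule lists_lepoll_mono)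
  also have "\<dots> \<lesssim> D" using D(1) by (rule infinite_lists_lepoll)
  finally show ?thesis .
qed

lemma single_one_mult:
  assumes "k \<in> carrier R" "f \<in> carrier A"
  shows "single \<one>\<^bsub>G\<^esub> k \<otimes>\<^bsub>A\<^esub> f = (\<lambda>g. k \<otimes> f g)"
proof
  fix g
  show "(single \<one>\<^bsub>G\<^esub> k \<otimes>\<^bsub>A\<^esub> f) g = k \<otimes> f g"
  proof (cases "g \<in> carrier G")
    case True
    then show ?thesis using assms by (simp add: single_mult)
  next
    case False
    then have "g \<notin> supp (single \<one>\<^bsub>G\<^esub> k \<otimes>\<^bsub>A\<^esub> f)" "g \<notin> supp f" by (auto dest: supp_closed)
    then show ?thesis
      using assms not_supp_zero[of f g] not_supp_zero[of "single \<one>\<^bsub>G\<^esub> k \<otimes>\<^bsub>A\<^esub> f" g] by simp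
  qed
qed

lemma mult_single_one:
  assumes "k \<in> carrier R" "f \<in> carrier A"
  shows "f \<otimes>\<^bsub>A\<^esub> single \<one>\<^bsub>G\<^esub> k = (\<lambda>g. f g \<otimes> k)"
proof
  fix g
  show "(f \<otimes>\<^bsub>A\<^esub> single \<one>\<^bsub>G\<^esub> k) g = f g \<otimes> k"
  proof (cases "g \<in> carrier G")
    case True
    let ?T = "insert g (supp f)"
    have "(f \<otimes>\<^bsub>A\<^esub> single \<one>\<^bsub>G\<^esub> k) g = (\<Oplus>x\<in>?T. f x \<otimes> single \<one>\<^bsub>G\<^esub> k (inv\<^bsub>G\<^esub> x \<otimes>\<^bsub>G\<^esub> g))"
      using assms True by (intro A_mult) (auto dest: supp_closed)
    also have "\<dots> = f g \<otimes> single \<one>\<^bsub>G\<^esub> k (inv\<^bsub>G\<^esub> g \<otimes>\<^bsub>G\<^esub> g)"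
    proof (rule finsum_single_term)
      fix x assume x: "x \<in> ?T" "x \<noteq> g"
      then have "x \<in> carrier G" by (auto dest: supp_closed)
      then have "inv\<^bsub>G\<^esub> x \<otimes>\<^bsub>G\<^esub> g \<noteq> \<one>\<^bsub>G\<^esub>"
        using x(2) True by (metis G.inv_closed G.inv_equality G.inv_inv)
      then show "f x \<otimes> single \<one>\<^bsub>G\<^esub> k (inv\<^bsub>G\<^esub> x \<otimes>\<^bsub>G\<^esub> g) = \<zero>"
        using assms by (simp add: single_def)
    qed (use assms in simp_all)
    finally show ?thesis using True by (simp add: single_def)
  next
    case False
    then have "g \<notin> supp (f \<otimes>\<^bsub>A\<^esub> single \<one>\<^bsub>G\<^esub> k)" "g \<notin> supp f" by (auto dest: supp_closed)
    then show ?thesis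
      using assms not_supp_zero[of f g] not_supp_zero[of "f \<otimes>\<^bsub>A\<^esub> single \<one>\<^bsub>G\<^esub> k" g] by simp
  qed
qed

text \<open>Since \<open>a x b\<close> determines \<open>a\<close> and \<open>b\<close>, a single
  summand of the convolution reaches this point: products through a generic \<open>x\<close> behave
  like tensors.\<close>

lemma coeff_generic_product:
  assumes p: "p \<in> carrier A" "supp p \<subseteq> F" and q: "q \<in> carrier A" "supp q \<subseteq> F"
    and F: "finite F" "F \<subseteq> carrier G" and x: "x \<in> carrier G"
    and gen: "\<And>a b a' b'. \<lbrakk>a \<in> F; b \<in> F; a' \<in> F; b' \<in> F;
      a \<otimes>\<^bsub>G\<^esub> (x \<otimes>\<^bsub>G\<^esub> b) = a' \<otimes>\<^bsub>G\<^esub> (x \<otimes>\<^bsub>G\<^esub> b')\<rbrakk> \<Longrightarrow> a = a' \<and> b = b'"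
    and ab: "a \<in> F" "b \<in> F"
  shows "(p \<otimes>\<^bsub>A\<^esub> (single x \<one> \<otimes>\<^bsub>A\<^esub> q)) (a \<otimes>\<^bsub>G\<^esub> (x \<otimes>\<^bsub>G\<^esub> b)) = p a \<otimes> q b"
proof -
  have Fc: "c \<in> carrier G" if "c \<in> F" for c using that F by blast
  let ?z = "a \<otimes>\<^bsub>G\<^esub> (x \<otimes>\<^bsub>G\<^esub> b)"
  have z: "?z \<in> carrier G" using Fc ab x by simp
  have "(p \<otimes>\<^bsub>A\<^esub> (single x \<one> \<otimes>\<^bsub>A\<^esub> q)) ?z =
      (\<Oplus>c\<in>F. p c \<otimes> (single x \<one> \<otimes>\<^bsub>A\<^esub> q) (inv\<^bsub>G\<^esub> c \<otimes>\<^bsub>G\<^esub> ?z))"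
    using p q F x z by (intro A_mult) auto
  also have "\<dots> = (\<Oplus>c\<in>F. p c \<otimes> q (inv\<^bsub>G\<^esub> x \<otimes>\<^bsub>G\<^esub> (inv\<^bsub>G\<^esub> c \<otimes>\<^bsub>G\<^esub> ?z)))"
    using p(1) q(1) x z Fc by (intro R.finsum_cong') (auto simp: single_mult)
  also have "\<dots> = p a \<otimes> q (inv\<^bsub>G\<^esub> x \<otimes>\<^bsub>G\<^esub> (inv\<^bsub>G\<^esub> a \<otimes>\<^bsub>G\<^esub> ?z))"
  proof (rule finsum_single_term[OF F(1) ab(1)])
    fix c assume c: "c \<in> F" "c \<noteq> a"
    let ?y = "inv\<^bsub>G\<^esub> x \<otimes>\<^bsub>G\<^esub> (inv\<^bsub>G\<^esub> c \<otimes>\<^bsub>G\<^esub> ?z)"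
    have "w = c \<otimes>\<^bsub>G\<^esub> (x \<otimes>\<^bsub>G\<^esub> (inv\<^bsub>G\<^esub> x \<otimes>\<^bsub>G\<^esub> (inv\<^bsub>G\<^esub> c \<otimes>\<^bsub>G\<^esub> w)))" if "w \<in> carrier G" for w
      using that Fc[OF c(1)] x by (simp add: G.m_assoc[symmetric])
    from this[OF z] have "?z = c \<otimes>\<^bsub>G\<^esub> (x \<otimes>\<^bsub>G\<^esub> ?y)" .
    then have "?y \<notin> supp q" using gen[OF ab c(1), of ?y] c(2) q(2) by blast
    then show "p c \<otimes> q ?y = \<zero>" using p(1) not_supp_zero[OF q(1)] by simp
  qed (use p q in simp)
  also have "inv\<^bsub>G\<^esub> x \<otimes>\<^bsub>G\<^esub> (inv\<^bsub>G\<^esub> a \<otimes>\<^bsub>G\<^esub> ?z) = b"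
    using Fc ab x by (simp add: G.m_assoc[symmetric])
  finally show ?thesis .
qed

text \<open>For commutative \<open>R\<close> and a subring \<open>Q\<close> this is tensor rank at
  most \<open>m\<close>, with RG viewed as the tensor product of \<open>R\<close> and QG over
  \<open>Q\<close>. Summands may be zero.\<close>

primrec coeff_span :: "'r set \<Rightarrow> nat \<Rightarrow> ('g \<Rightarrow> 'r) set" where
  "coeff_span Q 0 = {\<zero>\<^bsub>A\<^esub>}"
| "coeff_span Q (Suc m) = {single \<one>\<^bsub>G\<^esub> k \<otimes>\<^bsub>A\<^esub> b \<oplus>\<^bsub>A\<^esub> s | k b s.
     k \<in> carrier R \<and> b \<in> with_coeffs Q \<and> s \<in> coeff_span Q m}"

lemma coeff_span_carrier: "s \<in> coeff_span Q m \<Longrightarrow> s \<in> carrier A"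
  by (induction m arbitrary: s) (auto simp: with_coeffs_def)

text \<open>Each point of the support contributes one summand, with a group element as its
  \<open>b\<close>; the coefficients of the latter are 0 and 1. This gives the induction on length
  its start.\<close>

lemma mem_coeff_span:
  assumes Q: "\<zero> \<in> Q" "\<one> \<in> Q"
  shows "f \<in> carrier A \<Longrightarrow> card (supp f) = m \<Longrightarrow> f \<in> coeff_span Q m"
proof (induction m arbitrary: f)
  case 0
  then show ?case using supp_empty_iff[OF 0(1)] finite_supp[OF 0(1)] by simp
next
  case (Suc m)
  then have "supp f \<noteq> {}" by auto
  then obtain a where a: "a \<in> supp f" by blast
  then have ac: "a \<in> carrier G" by (rule supp_closed)
  let ?s = "\<lambda>g. if g = a then \<zero> else f g"
  have s: "supp ?s = supp f - {a}" by (auto simp: supp_def)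
  have fc: "f g \<in> carrier R" for g using Suc.prems(1) by simp
  have "?s \<in> carrier A"
    unfolding carrier_A_iff s using Suc.prems(1) not_supp_zero[OF Suc.prems(1)]
    by (auto simp: fc dest: supp_closed)
  moreover from this have "?s \<in> coeff_span Q m"
    using Suc a by (intro Suc.IH) (simp_all add: s)
  moreover have "single a \<one> \<in> with_coeffs Q"
    using Q ac by (simp add: with_coeffs_def) (simp add: single_def)
  moreover have "f = single \<one>\<^bsub>G\<^esub> (f a) \<otimes>\<^bsub>A\<^esub> single a \<one> \<oplus>\<^bsub>A\<^esub> ?s"
    using fc ac single_one_mult[of "f a" "single a \<one>"]
    by (simp add: fun_eq_iff A_add) (simp add: single_def)
  ultimately show ?case using fc by force
qed

lemma with_coeffs_minus:
  assumes Q: "Q \<subseteq> carrier R" "\<And>x y. \<lbrakk>x \<in> Q; y \<in> Q\<rbrakk> \<Longrightarrow> x \<ominus> y \<in> Q"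
    and f: "f \<in> with_coeffs Q" and h: "h \<in> with_coeffs Q"
  shows "f \<ominus>\<^bsub>A\<^esub> h \<in> with_coeffs Q"
proof -
  have c: "f \<in> carrier A" "h \<in> carrier A" using f h by (simp_all add: with_coeffs_def)
  have "(f \<ominus>\<^bsub>A\<^esub> h) g = f g \<ominus> h g" for g
  proof -
    have "(f \<ominus>\<^bsub>A\<^esub> h) \<oplus>\<^bsub>A\<^esub> h = f" using c by (simp add: A.minus_eq A.a_assoc A.l_neg)
    then have "(f \<ominus>\<^bsub>A\<^esub> h) g \<oplus> h g = f g" by (metis A_add)
    moreover have "f \<ominus>\<^bsub>A\<^esub> h \<in> carrier A" using c by simp
    ultimately show ?thesis using c
      by (metis R.add.inv_solve_right coeff_closed R.minus_eq a_inv_def)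
  qed
  then show ?thesis using Q f h c by (simp add: with_coeffs_def)
qed

lemma with_coeffs_mult:
  assumes Q: "Q \<subseteq> carrier R" "\<zero> \<in> Q" "\<And>x y. \<lbrakk>x \<in> Q; y \<in> Q\<rbrakk> \<Longrightarrow> x \<oplus> y \<in> Q"
    "\<And>x y. \<lbrakk>x \<in> Q; y \<in> Q\<rbrakk> \<Longrightarrow> x \<otimes> y \<in> Q"
    and f: "f \<in> with_coeffs Q" and h: "h \<in> with_coeffs Q"
  shows "f \<otimes>\<^bsub>A\<^esub> h \<in> with_coeffs Q"
proof -
  have c: "f \<in> carrier A" "h \<in> carrier A" using f h by (simp_all add: with_coeffs_def)
  have sum: "(\<Oplus>x\<in>S. p x) \<in> Q" if "finite S" "\<And>x. x \<in> S \<Longrightarrow> p x \<in> Q" for S and p :: "'g \<Rightarrow> 'r"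
    using that
  proof (induction S rule: finite_induct)
    case (insert x S)
    then have "p \<in> S \<rightarrow> carrier R" "p x \<in> carrier R" using Q(1) by auto
    then show ?case using insert Q(3) by simp
  qed (simp add: Q(2))
  have "(f \<otimes>\<^bsub>A\<^esub> h) g \<in> Q" if g: "g \<in> carrier G" for g
  proof -
    have "(f \<otimes>\<^bsub>A\<^esub> h) g = (\<Oplus>x\<in>supp f. f x \<otimes> h (inv\<^bsub>G\<^esub> x \<otimes>\<^bsub>G\<^esub> g))"
      using c g by (intro A_mult) (auto dest: supp_closed)
    also have "\<dots> \<in> Q"
      using c f h g by (intro sum Q(4)) (auto simp: with_coeffs_def dest: supp_closed)
    finally show ?thesis .
  qed
  then show ?thesis using c by (simp add: with_coeffs_def)
qed

text \<open>Scalars are central in the group ring of a commutative ring, so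
  \<open>b d f - f d b\<close> is linear in \<open>f\<close>. For \<open>b' = b\<close> the first
  bracket vanishes; this is how a summand is removed.\<close>

lemma commutator_expand:
  assumes comm: "cring R"
    and k: "k \<in> carrier R"
    and cl: "d \<in> carrier A" "b \<in> carrier A" "b' \<in> carrier A" "s \<in> carrier A"
  defines "c \<equiv> single \<one>\<^bsub>G\<^esub> k"
  shows "b \<otimes>\<^bsub>A\<^esub> (d \<otimes>\<^bsub>A\<^esub> (c \<otimes>\<^bsub>A\<^esub> b' \<oplus>\<^bsub>A\<^esub> s)) \<ominus>\<^bsub>A\<^esub> (c \<otimes>\<^bsub>A\<^esub> b' \<oplus>\<^bsub>A\<^esub> s) \<otimes>\<^bsub>A\<^esub> (d \<otimes>\<^bsub>A\<^esub> b) =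
    c \<otimes>\<^bsub>A\<^esub> (b \<otimes>\<^bsub>A\<^esub> (d \<otimes>\<^bsub>A\<^esub> b') \<ominus>\<^bsub>A\<^esub> b' \<otimes>\<^bsub>A\<^esub> (d \<otimes>\<^bsub>A\<^esub> b)) \<oplus>\<^bsub>A\<^esub>
    (b \<otimes>\<^bsub>A\<^esub> (d \<otimes>\<^bsub>A\<^esub> s) \<ominus>\<^bsub>A\<^esub> s \<otimes>\<^bsub>A\<^esub> (d \<otimes>\<^bsub>A\<^esub> b))"
proof -
  interpret cr: cring R by (rule comm)
  have c: "c \<in> carrier A" using k by (simp add: c_def)
  have central: "f \<otimes>\<^bsub>A\<^esub> c = c \<otimes>\<^bsub>A\<^esub> f" if "f \<in> carrier A" for f
    using that k by (simp add: c_def single_one_mult mult_single_one cr.m_comm)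
  have "b \<otimes>\<^bsub>A\<^esub> (d \<otimes>\<^bsub>A\<^esub> (c \<otimes>\<^bsub>A\<^esub> b')) = (b \<otimes>\<^bsub>A\<^esub> d) \<otimes>\<^bsub>A\<^esub> c \<otimes>\<^bsub>A\<^esub> b'"
    using cl c by (simp add: A.m_assoc)
  also have "\<dots> = c \<otimes>\<^bsub>A\<^esub> (b \<otimes>\<^bsub>A\<^esub> d) \<otimes>\<^bsub>A\<^esub> b'" using cl central[of "b \<otimes>\<^bsub>A\<^esub> d"] by simp
  finally have "b \<otimes>\<^bsub>A\<^esub> (d \<otimes>\<^bsub>A\<^esub> (c \<otimes>\<^bsub>A\<^esub> b')) = c \<otimes>\<^bsub>A\<^esub> (b \<otimes>\<^bsub>A\<^esub> (d \<otimes>\<^bsub>A\<^esub> b'))"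
    using cl c by (simp add: A.m_assoc)
  then show ?thesis
    using cl c
    by (simp add: A.minus_eq A.r_distr A.l_distr A.m_assoc A.r_minus A.minus_add A.a_ac)
qed

text \<open>By linearity each summand \<open>k b'\<close> becomes
  \<open>k (b x b' - b' x b)\<close>, whose second factor again has coefficients in the subring
  \<open>Q\<close>. So the length does not grow.\<close>

lemma coeff_span_commutator:
  assumes comm: "cring R"
    and Q: "subring Q R" and b: "b \<in> with_coeffs Q" and x: "x \<in> carrier G"
    and s: "s \<in> coeff_span Q m"
  shows "b \<otimes>\<^bsub>A\<^esub> (single x \<one> \<otimes>\<^bsub>A\<^esub> s) \<ominus>\<^bsub>A\<^esub> s \<otimes>\<^bsub>A\<^esub> (single x \<one> \<otimes>\<^bsub>A\<^esub> b) \<in> coeff_span Q m"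
  using s
proof (induction m arbitrary: s)
  case 0
  then show ?case using b x by (simp add: with_coeffs_def A.minus_eq)
next
  case (Suc m)
  let ?d = "single x \<one>"
  from Suc.prems obtain k b' s' where s: "s = single \<one>\<^bsub>G\<^esub> k \<otimes>\<^bsub>A\<^esub> b' \<oplus>\<^bsub>A\<^esub> s'"
    and k: "k \<in> carrier R" and b': "b' \<in> with_coeffs Q" and s': "s' \<in> coeff_span Q m" by auto
  have cl: "?d \<in> carrier A" "b \<in> carrier A" "b' \<in> carrier A" "s' \<in> carrier A"
    using k x b b' coeff_span_carrier[OF s'] by (auto simp: with_coeffs_def)
  have sub: "Q \<subseteq> carrier R" and zero: "\<zero> \<in> Q" and one: "\<one> \<in> Q"
    and add: "\<And>x y. \<lbrakk>x \<in> Q; y \<in> Q\<rbrakk> \<Longrightarrow> x \<oplus> y \<in> Q"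
    and mult: "\<And>x y. \<lbrakk>x \<in> Q; y \<in> Q\<rbrakk> \<Longrightarrow> x \<otimes> y \<in> Q"
    and minus: "\<And>x y. \<lbrakk>x \<in> Q; y \<in> Q\<rbrakk> \<Longrightarrow> x \<ominus> y \<in> Q"
    using subringE[OF Q] by (auto simp: R.minus_eq)
  have "?d \<in> with_coeffs Q" using x zero one by (simp add: with_coeffs_def) (simp add: single_def)
  then have "b \<otimes>\<^bsub>A\<^esub> (?d \<otimes>\<^bsub>A\<^esub> b') \<ominus>\<^bsub>A\<^esub> b' \<otimes>\<^bsub>A\<^esub> (?d \<otimes>\<^bsub>A\<^esub> b) \<in> with_coeffs Q"
    using b b' by (intro with_coeffs_minus with_coeffs_mult sub zero add mult minus)
  then show ?case
    unfolding s commutator_expand[OF comm k cl] using k Suc.IH[OF s'] by auto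
qed

text \<open>
  An element of the ideal of least length \<open>m\<close> with respect to \<open>coeff_span\<close>, with a summand
  \<open>k b\<close>, must satisfy \<open>b x f = f x b\<close> since the difference is shorter.  For generic \<open>x\<close> the
  coefficients of the two sides can be compared one by one, and \<open>f\<close> is a scalar multiple of \<open>b\<close>.
\<close>

lemma ideal_meets_with_coeffs:
  assumes fld: "field R" and PHP: "PHP G" and Q: "subring Q R"
    and I: "ideal I A" and f: "f \<in> I" "f \<noteq> \<zero>\<^bsub>A\<^esub>"
  shows "\<exists>b\<in>with_coeffs Q. b \<in> I \<and> b \<noteq> \<zero>\<^bsub>A\<^esub>"
proof -
  interpret fld: field R by (rule fld)
  interpret I: ideal I A by (rule I)
  have "f \<in> coeff_span Q m \<Longrightarrow> f \<in> I \<Longrightarrow> f \<noteq> \<zero>\<^bsub>A\<^esub> \<Longrightarrow> ?thesis" for m f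
  proof (induction m arbitrary: f)
    case 0
    then show ?case by simp
  next
    case (Suc m)
    then obtain k b s where fs: "f = single \<one>\<^bsub>G\<^esub> k \<otimes>\<^bsub>A\<^esub> b \<oplus>\<^bsub>A\<^esub> s"
      and k: "k \<in> carrier R" and b: "b \<in> with_coeffs Q" and s: "s \<in> coeff_span Q m" by auto
    have fc: "f \<in> carrier A" and bc: "b \<in> carrier A" and sc: "s \<in> carrier A"
      using Suc.prems(2) I.a_subset b coeff_span_carrier[OF s] by (auto simp: with_coeffs_def)
    have kc: "single \<one>\<^bsub>G\<^esub> k \<in> carrier A" using k by simp
    show ?case
    proof (cases "b = \<zero>\<^bsub>A\<^esub>")
      case True
      then have "f = s" using kc sc by (simp add: fs)
      then show ?thesis using Suc s by blast
    next
      case b0: False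
      let ?F = "supp f \<union> supp b"
      have F: "?F \<subseteq> carrier G" "finite ?F" using fc bc by (auto dest: supp_closed)
      obtain x where x: "x \<in> carrier G"
        and gen: "\<And>a b a' b'. \<lbrakk>a \<in> ?F; b \<in> ?F; a' \<in> ?F; b' \<in> ?F;
          a \<otimes>\<^bsub>G\<^esub> (x \<otimes>\<^bsub>G\<^esub> b) = a' \<otimes>\<^bsub>G\<^esub> (x \<otimes>\<^bsub>G\<^esub> b')\<rbrakk> \<Longrightarrow> a = a' \<and> b = b'"
        using G.PHP_generic_element[OF PHP F] by blast
      let ?d = "single x \<one>"
      let ?g = "b \<otimes>\<^bsub>A\<^esub> (?d \<otimes>\<^bsub>A\<^esub> f) \<ominus>\<^bsub>A\<^esub> f \<otimes>\<^bsub>A\<^esub> (?d \<otimes>\<^bsub>A\<^esub> b)"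
      have dc: "?d \<in> carrier A" using x by simp
      have "?g = b \<otimes>\<^bsub>A\<^esub> (?d \<otimes>\<^bsub>A\<^esub> s) \<ominus>\<^bsub>A\<^esub> s \<otimes>\<^bsub>A\<^esub> (?d \<otimes>\<^bsub>A\<^esub> b)"
        unfolding fs commutator_expand[OF fld.is_cring k dc bc bc sc]
        using kc dc bc sc by (simp add: A.minus_eq A.r_neg)
      then have g_span: "?g \<in> coeff_span Q m"
        using coeff_span_commutator[OF fld.is_cring Q b x s] by simp
      have gI: "?g \<in> I"
        unfolding A.minus_eq using Suc.prems(2) bc dc
        by (intro I.a_closed I.a_inv_closed I.I_l_closed I.I_r_closed) auto
      show ?thesis
      proof (cases "?g = \<zero>\<^bsub>A\<^esub>")
        case False
        then show ?thesis using Suc.IH g_span gI by blast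
      next
        case True
        moreover have "b \<otimes>\<^bsub>A\<^esub> (?d \<otimes>\<^bsub>A\<^esub> f) \<in> carrier A" "f \<otimes>\<^bsub>A\<^esub> (?d \<otimes>\<^bsub>A\<^esub> b) \<in> carrier A"
          using bc dc fc by simp_all
        ultimately have eq: "b \<otimes>\<^bsub>A\<^esub> (?d \<otimes>\<^bsub>A\<^esub> f) = f \<otimes>\<^bsub>A\<^esub> (?d \<otimes>\<^bsub>A\<^esub> b)"
          by simp
        \<comment> \<open>Comparison of the coefficients at the point \<open>a x a'\<close>: the
          coefficient vectors of \<open>b\<close> and \<open>f\<close> are proportional.\<close>
        have swap: "b a \<otimes> f a' = f a \<otimes> b a'" if "a \<in> ?F" "a' \<in> ?F" for a a'
        proof -
          have "(b \<otimes>\<^bsub>A\<^esub> (?d \<otimes>\<^bsub>A\<^esub> f)) (a \<otimes>\<^bsub>G\<^esub> (x \<otimes>\<^bsub>G\<^esub> a')) = b a \<otimes> f a'"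
            by (rule coeff_generic_product[OF bc _ fc _ F(2,1) x _ that])
              ((rule Un_upper1 Un_upper2 gen; assumption)+)
          moreover have "(f \<otimes>\<^bsub>A\<^esub> (?d \<otimes>\<^bsub>A\<^esub> b)) (a \<otimes>\<^bsub>G\<^esub> (x \<otimes>\<^bsub>G\<^esub> a')) = f a \<otimes> b a'"
            by (rule coeff_generic_product[OF fc _ bc _ F(2,1) x _ that])
              ((rule Un_upper1 Un_upper2 gen; assumption)+)
          ultimately show ?thesis by (simp only: eq)
        qed
        obtain a where a: "a \<in> supp b" using b0 supp_empty_iff[OF bc] by blast
        then have ba: "b a \<in> carrier R" "b a \<noteq> \<zero>" using bc by (auto simp: supp_def)
        then have inv: "inv (b a) \<in> carrier R" "inv (b a) \<otimes> b a = \<one>"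
          using fld.field_Units by auto
        let ?c = "inv (b a) \<otimes> f a"
        have cc: "?c \<in> carrier R" using inv fc by simp
        have f_eq: "f = single \<one>\<^bsub>G\<^esub> ?c \<otimes>\<^bsub>A\<^esub> b"
        proof
          fix g
          show "f g = (single \<one>\<^bsub>G\<^esub> ?c \<otimes>\<^bsub>A\<^esub> b) g"
          proof (cases "g \<in> ?F")
            case True
            have "f g = inv (b a) \<otimes> (b a \<otimes> f g)"
              using inv ba fc by (simp add: R.m_assoc[symmetric])
            also have "\<dots> = inv (b a) \<otimes> (f a \<otimes> b g)" using swap[of a g] a True by simp
            finally show ?thesis
              using inv fc bc cc by (simp add: single_one_mult R.m_assoc)
          next
            case False
            then have "f g = \<zero>" "b g = \<zero>" using not_supp_zero[OF fc] not_supp_zero[OF bc] by auto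
            then show ?thesis using cc bc by (simp add: single_one_mult)
          qed
        qed
        have "?c \<noteq> \<zero>"
        proof
          assume "?c = \<zero>"
          then have "f = (\<lambda>g. \<zero>)" using f_eq bc by (simp add: single_one_mult)
          then show False using Suc.prems(3) by (simp add: A_zero)
        qed
        then have inv': "inv ?c \<in> carrier R" "inv ?c \<otimes> ?c = \<one>"
          using fld.field_Units cc by auto
        have "single \<one>\<^bsub>G\<^esub> (inv ?c) \<otimes>\<^bsub>A\<^esub> f = b"
        proof -
          have "(single \<one>\<^bsub>G\<^esub> (inv ?c) \<otimes>\<^bsub>A\<^esub> f) g = b g" for g
          proof -
            have "f g = ?c \<otimes> b g" using f_eq cc bc by (metis single_one_mult)
            then have "inv ?c \<otimes> f g = b g"
              using inv' cc bc by (simp del: R.m_assoc add: R.m_assoc[symmetric])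
            then show ?thesis using inv' fc by (simp add: single_one_mult)
          qed
          then show ?thesis by blast
        qed
        then have "b \<in> I"
          using I.I_l_closed[OF Suc.prems(2), of "single \<one>\<^bsub>G\<^esub> (inv ?c)"] inv' by simp
        then show ?thesis using b b0 by blast
      qed
    qed
  qed
  moreover have "f \<in> coeff_span Q (card (supp f))"
    using f I.a_subset subringE[OF Q] by (intro mem_coeff_span) auto
  ultimately show ?thesis using f by blast
qed

end

text \<open>The image of the integers serves as the small coefficient ring in every characteristic,
  and it is countable however large the field is.\<close>

lemma (in ring) subring_range_of_int: "subring (range (\<lambda>k :: int. add_pow R k \<one>)) R"
proof (rule subringI)
  show "range (\<lambda>k :: int. add_pow R k \<one>) \<subseteq> carrier R" by auto
  show "\<one> \<in> range (\<lambda>k :: int. add_pow R k \<one>)"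
    using add.int_pow_1[of \<one>] by (intro image_eqI[of _ _ 1]) simp_all
next
  fix x y assume "x \<in> range (\<lambda>k :: int. add_pow R k \<one>)" "y \<in> range (\<lambda>k :: int. add_pow R k \<one>)"
  then obtain k l :: int where x: "x = add_pow R k \<one>" and y: "y = add_pow R l \<one>" by blast
  have "x \<oplus> y = add_pow R (k + l) \<one>"
    unfolding x y using add.int_pow_mult[of \<one> k l] by simp
  then show "x \<oplus> y \<in> range (\<lambda>k :: int. add_pow R k \<one>)" by blast
  have "x \<otimes> y = add_pow R k (add_pow R l \<one>)"
    unfolding x y by (simp add: add_pow_ldistr_int)
  also have "\<dots> = add_pow R (l * k) \<one>"
    using add.int_pow_pow[of \<one> k l] by simp
  finally show "x \<otimes> y \<in> range (\<lambda>k :: int. add_pow R k \<one>)" by blast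
next
  fix x assume "x \<in> range (\<lambda>k :: int. add_pow R k \<one>)"
  then obtain k :: int where x: "x = add_pow R k \<one>" by blast
  have "\<ominus> x = add_pow R (- k) \<one>"
    unfolding x using add.int_pow_neg[of \<one> k] by simp
  then show "\<ominus> x \<in> range (\<lambda>k :: int. add_pow R k \<one>)" by blast
qed

text \<open>The common part of both assertions, with \<open>Q\<close> the whole ring or the image of
  the integers. As \<open>D\<close> is infinite and bounds both \<open>G\<close> and
  \<open>Q\<close>, the triples that need a free factor of their own embed into
  \<open>D\<close>.\<close>

lemma (in group_algebra) right_primitive_if_small:
  assumes nz: "\<And>a b. \<lbrakk>a \<in> carrier R; b \<in> carrier R; a \<otimes> b = \<zero>\<rbrakk> \<Longrightarrow> a = \<zero> \<or> b = \<zero>"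
    and one: "\<one> \<noteq> \<zero>" and PHP: "PHP G"
    and D: "infinite D" "carrier G \<lesssim> D" "free_family G D u"
    and Q: "Q \<lesssim> D"
    and dense: "\<And>a. \<lbrakk>a \<in> carrier A; a \<noteq> \<zero>\<^bsub>A\<^esub>\<rbrakk> \<Longrightarrow>
      \<exists>b\<in>with_coeffs Q. b \<in> genideal A {a} \<and> b \<noteq> \<zero>\<^bsub>A\<^esub>"
  shows "right_primitive A"
proof -
  let ?T = "with_coeffs Q - {\<zero>\<^bsub>A\<^esub>}"
  have "?T \<lesssim> D"
    using with_coeffs_lepoll[OF D(1,2) Q] by (meson Diff_subset lepoll_trans subset_imp_lepoll)
  moreover have "(UNIV :: (nat \<times> nat) set) \<lesssim> D"
  proof -
    have "(UNIV :: nat set) \<lesssim> D" using D(1) by (simp add: infinite_le_lepoll)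
    then have "(UNIV :: nat set) \<times> (UNIV :: nat set) \<lesssim> D"
      using D(1) by (intro infinite_times_lepoll)
    then show ?thesis by simp
  qed
  ultimately have "?T \<times> (UNIV :: (nat \<times> nat) set) \<lesssim> D" by (rule infinite_times_lepoll[OF D(1)])
  then obtain f where f: "inj_on f (?T \<times> (UNIV :: (nat \<times> nat) set))"
    "f ` (?T \<times> UNIV) \<subseteq> D"
    unfolding lepoll_def by blast
  from free_family_reindex[OF D(3) f]
  have u: "free_family G (?T \<times> UNIV \<times> UNIV) (u \<circ> f)" by simp
  have T: "?T \<subseteq> carrier A - {\<zero>\<^bsub>A\<^esub>}" by (auto simp: with_coeffs_def)
  show ?thesis
  proof (rule right_primitive_group_ring[OF _ one PHP u T])
    show "\<exists>b\<in>?T. b \<in> genideal A {a}" if "a \<in> carrier A" "a \<noteq> \<zero>\<^bsub>A\<^esub>" for a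
      using dense[OF that] by blast
  qed (rule nz)
qed

theorem theorem1p1:
  fixes G :: "('g, 'x) monoid_scheme"
  assumes "group G"
    and "PHP G"
    and "\<exists>H. subgroup H G \<and> free_group (G\<lparr>carrier := H\<rparr>) \<and>
             \<not> comm_group (G\<lparr>carrier := H\<rparr>) \<and> H \<approx> carrier G"
  shows "(\<forall>R :: ('r, 'y) ring_scheme.
            nc_domain R \<and> carrier R \<lesssim> carrier G \<longrightarrow> right_primitive (group_ring R G)) \<and>
         (\<forall>K :: ('k, 'z) ring_scheme. field K \<longrightarrow> right_primitive (group_ring K G))"
proof -
  interpret G: group G by fact
  obtain H where H: "subgroup H G" "free_group (G\<lparr>carrier := H\<rparr>)"
    "\<not> comm_group (G\<lparr>carrier := H\<rparr>)" "H \<approx> carrier G"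
    using assms(3) by blast
  obtain D :: "'g list set" and u where D: "infinite D" "H \<lesssim> D"
    and u0: "free_family (G\<lparr>carrier := H\<rparr>) D u"
    by (rule free_group_imp_free_family[OF H(2,3)]) simp
  have GD: "carrier G \<lesssim> D" using H(4) D(2) eqpoll_sym lepoll_trans1 by blast
  have u: "free_family G D u" using G.free_family_subgroup[OF H(1) u0] .
  show ?thesis
  proof (intro conjI allI impI)
    fix R :: "('r, 'y) ring_scheme"
    assume "nc_domain R \<and> carrier R \<lesssim> carrier G"
    then have R: "nc_domain R" and small: "carrier R \<lesssim> carrier G" by auto
    interpret R: nc_domain R by (rule R)
    interpret group_algebra R G by unfold_locales
    show "right_primitive (group_ring R G)"
    proof (rule right_primitive_if_small[OF _ R.one_not_zero \<open>PHP G\<close> D(1) GD u])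
      show "carrier R \<lesssim> D" using small GD by (rule lepoll_trans)
      \<comment> \<open>With all coefficients allowed, \<open>b = a\<close> serves.\<close>
      show "\<exists>b\<in>with_coeffs (carrier R). b \<in> genideal A {a} \<and> b \<noteq> \<zero>\<^bsub>A\<^esub>"
        if "a \<in> carrier A" "a \<noteq> \<zero>\<^bsub>A\<^esub>" for a
        using that A.genideal_self' by (auto simp: with_coeffs_carrier)
    qed (rule R.no_zero_divisors)
  next
    fix K :: "('k, 'z) ring_scheme"
    assume K: "field K"
    interpret K: field K by (rule K)
    interpret group_algebra K G by unfold_locales
    let ?Q = "range (\<lambda>k :: int. add_pow K k \<one>\<^bsub>K\<^esub>)"
    show "right_primitive (group_ring K G)"
    proof (rule right_primitive_if_small[OF _ K.one_not_zero \<open>PHP G\<close> D(1) GD u])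
      have "?Q \<lesssim> (UNIV :: int set)" by (rule image_lepoll)
      also have "\<dots> \<lesssim> (UNIV :: nat set)"
        using countable_def[of "UNIV :: int set"] by (auto simp: lepoll_def)
      also have "\<dots> \<lesssim> D" using D(1) by (simp add: infinite_le_lepoll)
      finally show "?Q \<lesssim> D" .
      fix a assume a: "a \<in> carrier A" "a \<noteq> \<zero>\<^bsub>A\<^esub>"
      then have "ideal (genideal A {a}) A" by (intro A.genideal_ideal) simp
      then show "\<exists>b\<in>with_coeffs ?Q. b \<in> genideal A {a} \<and> b \<noteq> \<zero>\<^bsub>A\<^esub>"
        using ideal_meets_with_coeffs[OF K \<open>PHP G\<close> K.subring_range_of_int] A.genideal_self' a
        by blast
    qed (use K.integral in blast)
  qed
qed

end
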